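(* Let $\Lambda$ be a row-finite $k$-graph, let $\widetilde\Lambda$ be its desourcification and $\iota:\Lambda\to\widetilde\Lambda$ the canonical embedding. For $x\in\iota(\Lambda^0)\widetilde\Lambda^\infty$ let $p_x=\bigvee\{p\in\mathbb N^k: x(0,p)\in\iota(\Lambda)\}$ and let $\pi(x)$ be the restriction of $x$ to $\Omega_{k,p_x}$. Then $\pi:\iota(\Lambda^0)\widetilde\Lambda^\infty\to\iota(\partial\Lambda)$ is a homeomorphism, where both sets carry the relative topology from $W_{\widetilde\Lambda}$.
   Context: Conventions: $\mathbb N=\{0,1,2,\dots\}$; $e_1,\dots,e_k$ are the standard generators of $\mathbb N^k$; $(\mathbb N\cup\{\infty\})^k$ is ordered coordinatewise; $\wedge,\vee$ (and $\bigvee$) are coordinatewise minimum and maximum (supremum). A $k$-graph is a countable category $\Lambda$ with a functor $d:\Lambda\to\mathbb N^k$ (degree) satisfying the factorisation property: whenever $d(\lambda)=m+n$ there are unique $\mu,\nu$ with $\lambda=\mu\nu$, $d(\mu)=m$, $d(\nu)=n$. $\lambda\in\Lambda$ means $\lambda$ is a morphism (path), $r,s$ are codomain and domain ($\lambda\mu$ is defined iff $s(\lambda)=r(\mu)$). $\Lambda^n=d^{-1}(n)$; $\Lambda^0$ is identified with the objects (vertices). A $k$-graph morphism is a degree-preserving functor. For $m\in(\mathbb N\cup\{\infty\})^k$, $\Omega_{k,m}$ is the $k$-graph with objects $p\in\mathbb N^k$, $p\le m$, morphisms $(p,q)$ with $p\le q\le m$, $r(p,q)=p$, $s(p,q)=q$,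 $d(p,q)=q-p$, $(p,q)(q,t)=(p,t)$. $\Lambda^m$ also denotes the set of $k$-graph morphisms $x:\Omega_{k,m}\to\Lambda$, with $d(x):=m$, $x(n):=x(n,n)$, $r(x):=x(0)$; for $m\in\mathbb N^k$ these are identified with the paths of degree $m$ ($\lambda(p,q)$ being the unique middle factor $\lambda''$ of $\lambda=\lambda'\lambda''\lambda'''$ with $d(\lambda')=p$, $d(\lambda'')=q-p$). $\Lambda^\infty$ is $\Lambda^m$ for $m=(\infty,\dots,\infty)$. $W_\Lambda=\bigcup_m\Lambda^m$ is the path space. For a set $X$ of (finite or infinite) paths and a set $V$ of vertices, $VX=\{x\in X:r(x)\in V\}$, $vX=\{v\}X$. If $\lambda\in\Lambda$, $x\in W_\Lambda$, $r(x)=s(\lambda)$, then $\lambda x$ is the unique element of $W_\Lambda$ of degree $d(\lambda)+d(x)$ with $(\lambda x)(0,d(\lambda))=\lambda$ and $(\lambda x)(d(\lambda),d(\lambda)+n)=x(0,n)$ for $n\le d(x)$. For $n\in\mathbb N^k$, $n\le d(x)$, $\sigma^n(x)$ has degree $d(x)-n$ and $\sigma^n(x)(p,q)=x(p+n,q+n)$. $\mathrm{MCE}(\mu,\nu)$ is the set of $\lambda\in\Lambda$ with $\lambda=\mu\alpha=\nu\beta$ for some $\alpha,\beta$ and $d(\lambda)=d(\mu)\vee d(\nu)$. $\Lambda$ is row-finite if all $v\Lambda^n$ are finite; finitely aligned if all $\mathrm{MCE}(\mu,\nu)$ are finite (row-finite implies finitely aligned). Boundary paths: $E\subset v\Lambda$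 is exhaustive if for every $\mu\in v\Lambda$ there is $\lambda\in E$ with $\mathrm{MCE}(\lambda,\mu)\neq\emptyset$; $v\mathcal{FE}(\Lambda)$ is the set of finite exhaustive subsets of $v\Lambda$. $x\in W_\Lambda$ is a boundary path if for all $n\in\mathbb N^k$ with $n\le d(x)$ and all $E\in x(n)\mathcal{FE}(\Lambda)$ there is $m\in\mathbb N^k$ ($n\le m\le d(x)$) with $x(n,m)\in E$. $\partial\Lambda$ is the set of boundary paths. Topology: $\mathcal Z(\mu)=\{x\in W_\Lambda:d(x)\ge d(\mu),x(0,d(\mu))=\mu\}$, and for finite $G\subset s(\mu)\Lambda$, $\mathcal Z(\mu\setminus G)=\mathcal Z(\mu)\setminus\bigcup_{\nu\in G}\mathcal Z(\mu\nu)$; the sets $\mathcal Z(\mu\setminus G)$ form a base for the topology on $W_\Lambda$. Desourcification of a finitely aligned $\Lambda$: on $\{(x;m):x\in\partial\Lambda,m\in\mathbb N^k\}$ let $(x;m)\approx(y;p)$ iff $x(m\wedge d(x))=y(p\wedge d(y))$ and $m-m\wedge d(x)=p-p\wedge d(y)$. On $\{(x;(m,n)):x\in\partial\Lambda,\ m\le n\in\mathbb N^k\}$ let $(x;(m,n))\sim(y;(p,q))$ iff $x(m\wedge d(x),n\wedge d(x))=y(p\wedge d(y),q\wedge d(y))$, $m-m\wedge d(x)=p-p\wedge d(y)$ and $n-m=q-p$. Classes are written $[x;m]$, $[x;(m,n)]$. $\widetilde\Lambda$ is the category with objects $[x;m]$, morphisms $[x;(m,n)]$, range $[x;m]$, source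 $[x;n]$, identities $[x;(m,m)]$, composition $[x;(m,n)]\circ[y;(p,q)]=[z;(m,n+q-p)]$ when $[x;n]=[y;p]$, where $z=x(0,n\wedge d(x))\,\sigma^{p\wedge d(y)}(y)$, and degree $[x;(m,n)]\mapsto n-m$. It is a known fact that this is a finitely aligned $k$-graph with no sources, row-finite if $\Lambda$ is. The embedding is $\iota(\lambda)=[\lambda x;(0,d(\lambda))]$ for any $x\in s(\lambda)\partial\Lambda$ (independent of $x$); it extends to $\iota:W_\Lambda\to W_{\widetilde\Lambda}$ by $\iota(x)(p,q)=\iota(x(p,q))$. *)

theory Defs
  imports
    "HOL-Analysis.Analysis"
    "HOL-Library.Function_Algebras"
    "HOL-Library.Extended_Nat"
begin

section \<open>Degrees\<close>

text \<open>
  Elements of \<open>\<nat>\<^sup>k\<close> are functions on \<^typ>\<open>nat\<close> that vanish outside \<open>{0, \<dots>, k - 1}\<close>, and likewise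
  elements of \<open>(\<nat> \<union> {\<infinity>})\<^sup>k\<close>, so that \<open>k\<close> is an arbitrary natural number (0 included). Order,
  suprema and arithmetic are the pointwise operations on functions.
\<close>

definition NN :: "nat \<Rightarrow> (nat \<Rightarrow> nat) set" where
  "NN k = {p. \<forall>i\<ge>k. p i = 0}"

definition NNinf :: "nat \<Rightarrow> (nat \<Rightarrow> enat) set" where
  "NNinf k = {p. \<forall>i\<ge>k. p i = 0}"

definition fin :: "(nat \<Rightarrow> nat) \<Rightarrow> nat \<Rightarrow> enat" where
  "fin p = (\<lambda>i. enat (p i))"

definition infdeg :: "nat \<Rightarrow> nat \<Rightarrow> enat" where
  "infdeg k = (\<lambda>i. if i < k then \<infinity> else 0)"

text \<open>\<open>meetd m D\<close> is \<open>m \<and> D\<close>, which is finite because \<open>m\<close> is.\<close>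

definition meetd :: "(nat \<Rightarrow> nat) \<Rightarrow> (nat \<Rightarrow> enat) \<Rightarrow> nat \<Rightarrow> nat" where
  "meetd m D = (\<lambda>i. the_enat (inf (enat (m i)) (D i)))"


section \<open>\<open>k\<close>-graphs\<close>

text \<open>\<open>cmp \<mu> \<nu>\<close> is the composite \<open>\<mu>\<nu>\<close>, meaningful when \<open>src \<mu> = rng \<nu>\<close>.\<close>

record ('o, 'm) kgraph =
  Obj :: "'o set"
  Mor :: "'m set"
  rng :: "'m \<Rightarrow> 'o"
  src :: "'m \<Rightarrow> 'o"
  idm :: "'o \<Rightarrow> 'm"
  cmp :: "'m \<Rightarrow> 'm \<Rightarrow> 'm"
  deg :: "'m \<Rightarrow> nat \<Rightarrow> nat"

locale category =
  fixes C :: "('o, 'm) kgraph"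
  assumes rng_Obj: "\<mu> \<in> Mor C \<Longrightarrow> rng C \<mu> \<in> Obj C"
    and src_Obj: "\<mu> \<in> Mor C \<Longrightarrow> src C \<mu> \<in> Obj C"
    and idm_Mor: "v \<in> Obj C \<Longrightarrow> idm C v \<in> Mor C"
    and rng_idm: "v \<in> Obj C \<Longrightarrow> rng C (idm C v) = v"
    and src_idm: "v \<in> Obj C \<Longrightarrow> src C (idm C v) = v"
    and cmp_Mor: "\<mu> \<in> Mor C \<Longrightarrow> \<nu> \<in> Mor C \<Longrightarrow> src C \<mu> = rng C \<nu> \<Longrightarrow> cmp C \<mu> \<nu> \<in> Mor C"
    and rng_cmp: "\<mu> \<in> Mor C \<Longrightarrow> \<nu> \<in> Mor C \<Longrightarrow> src C \<mu> = rng C \<nu> \<Longrightarrow> rng C (cmp C \<mu> \<nu>) = rng C \<mu>"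
    and src_cmp: "\<mu> \<in> Mor C \<Longrightarrow> \<nu> \<in> Mor C \<Longrightarrow> src C \<mu> = rng C \<nu> \<Longrightarrow> src C (cmp C \<mu> \<nu>) = src C \<nu>"
    and cmp_idm_left: "\<mu> \<in> Mor C \<Longrightarrow> cmp C (idm C (rng C \<mu>)) \<mu> = \<mu>"
    and cmp_idm_right: "\<mu> \<in> Mor C \<Longrightarrow> cmp C \<mu> (idm C (src C \<mu>)) = \<mu>"
    and cmp_assoc: "\<mu> \<in> Mor C \<Longrightarrow> \<nu> \<in> Mor C \<Longrightarrow> \<kappa> \<in> Mor C \<Longrightarrow>
      src C \<mu> = rng C \<nu> \<Longrightarrow> src C \<nu> = rng C \<kappa> \<Longrightarrow>
      cmp C (cmp C \<mu> \<nu>) \<kappa> = cmp C \<mu> (cmp C \<nu> \<kappa>)"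

locale k_graph = category \<Lambda>
  for k :: nat and \<Lambda> :: "('o, 'm) kgraph" +
  assumes countable_Mor: "countable (Mor \<Lambda>)"
    and deg_NN: "\<mu> \<in> Mor \<Lambda> \<Longrightarrow> deg \<Lambda> \<mu> \<in> NN k"
    and deg_idm: "v \<in> Obj \<Lambda> \<Longrightarrow> deg \<Lambda> (idm \<Lambda> v) = 0"
    and deg_cmp: "\<mu> \<in> Mor \<Lambda> \<Longrightarrow> \<nu> \<in> Mor \<Lambda> \<Longrightarrow> src \<Lambda> \<mu> = rng \<Lambda> \<nu> \<Longrightarrow>
      deg \<Lambda> (cmp \<Lambda> \<mu> \<nu>) = deg \<Lambda> \<mu> + deg \<Lambda> \<nu>"
    and factorisation: "\<kappa> \<in> Mor \<Lambda> \<Longrightarrow> m \<in> NN k \<Longrightarrow> n \<in> NN k \<Longrightarrow> deg \<Lambda> \<kappa> = m + n \<Longrightarrow>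
      \<exists>!(\<mu>, \<nu>). \<mu> \<in> Mor \<Lambda> \<and> \<nu> \<in> Mor \<Lambda> \<and> src \<Lambda> \<mu> = rng \<Lambda> \<nu> \<and> \<kappa> = cmp \<Lambda> \<mu> \<nu> \<and>
        deg \<Lambda> \<mu> = m \<and> deg \<Lambda> \<nu> = n"

definition kgraph_morphism ::
    "('o, 'm) kgraph \<Rightarrow> ('p, 'n) kgraph \<Rightarrow> ('o \<Rightarrow> 'p) \<Rightarrow> ('m \<Rightarrow> 'n) \<Rightarrow> bool" where
  "kgraph_morphism \<Gamma> \<Lambda> f F \<longleftrightarrow>
     (\<forall>v\<in>Obj \<Gamma>. f v \<in> Obj \<Lambda> \<and> F (idm \<Gamma> v) = idm \<Lambda> (f v)) \<and>
     (\<forall>\<mu>\<in>Mor \<Gamma>. F \<mu> \<in> Mor \<Lambda> \<and> rng \<Lambda> (F \<mu>) = f (rng \<Gamma> \<mu>) \<and> src \<Lambda> (F \<mu>) = f (src \<Gamma> \<mu>) \<and>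
        deg \<Lambda> (F \<mu>) = deg \<Gamma> \<mu>) \<and>
     (\<forall>\<mu>\<in>Mor \<Gamma>. \<forall>\<nu>\<in>Mor \<Gamma>. src \<Gamma> \<mu> = rng \<Gamma> \<nu> \<longrightarrow> F (cmp \<Gamma> \<mu> \<nu>) = cmp \<Lambda> (F \<mu>) (F \<nu>))"

text \<open>\<open>\<Lambda>\<^sup>0\<close>, as a set of morphisms (by factorisation, the identity morphisms).\<close>

definition vertices :: "('o, 'm) kgraph \<Rightarrow> 'm set" where
  "vertices \<Lambda> = {\<mu> \<in> Mor \<Lambda>. deg \<Lambda> \<mu> = 0}"

text \<open>\<open>v\<Lambda>\<close>, for an object \<open>v\<close>.\<close>

definition paths_from :: "('o, 'm) kgraph \<Rightarrow> 'o \<Rightarrow> 'm set" where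
  "paths_from \<Lambda> v = {\<mu> \<in> Mor \<Lambda>. rng \<Lambda> \<mu> = v}"

definition row_finite :: "nat \<Rightarrow> ('o, 'm) kgraph \<Rightarrow> bool" where
  "row_finite k \<Lambda> \<longleftrightarrow> (\<forall>v\<in>Obj \<Lambda>. \<forall>n\<in>NN k. finite {\<mu> \<in> paths_from \<Lambda> v. deg \<Lambda> \<mu> = n})"

definition MCE :: "('o, 'm) kgraph \<Rightarrow> 'm \<Rightarrow> 'm \<Rightarrow> 'm set" where
  "MCE \<Lambda> \<mu> \<nu> = {\<kappa> \<in> Mor \<Lambda>.
     (\<exists>\<alpha>\<in>Mor \<Lambda>. src \<Lambda> \<mu> = rng \<Lambda> \<alpha> \<and> \<kappa> = cmp \<Lambda> \<mu> \<alpha>) \<and>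
     (\<exists>\<beta>\<in>Mor \<Lambda>. src \<Lambda> \<nu> = rng \<Lambda> \<beta> \<and> \<kappa> = cmp \<Lambda> \<nu> \<beta>) \<and>
     deg \<Lambda> \<kappa> = sup (deg \<Lambda> \<mu>) (deg \<Lambda> \<nu>)}"


section \<open>The path space\<close>

definition Omega :: "nat \<Rightarrow> (nat \<Rightarrow> enat) \<Rightarrow> (nat \<Rightarrow> nat, (nat \<Rightarrow> nat) \<times> (nat \<Rightarrow> nat)) kgraph" where
  "Omega k m =
    \<lparr>Obj = {p \<in> NN k. fin p \<le> m},
     Mor = {(p, q). p \<in> NN k \<and> q \<in> NN k \<and> p \<le> q \<and> fin q \<le> m},
     rng = fst,
     src = snd,
     idm = (\<lambda>p. (p, p)),
     cmp = (\<lambda>a b. (fst a, snd b)),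
     deg = (\<lambda>(p, q). q - p)\<rparr>"

text \<open>
  A path \<open>x\<close> is stored as its degree together with the morphism part of the functor \<open>x\<close>; the object
  part is determined by the morphism part. Requiring the morphism part to be extensional makes
  equality of functors the same as equality of the representing terms.
\<close>

datatype 'm kpath = KPath (pdeg: "nat \<Rightarrow> enat") (pmor: "(nat \<Rightarrow> nat) \<times> (nat \<Rightarrow> nat) \<Rightarrow> 'm")

definition paths_of_degree :: "nat \<Rightarrow> ('o, 'm) kgraph \<Rightarrow> (nat \<Rightarrow> enat) \<Rightarrow> 'm kpath set" where
  "paths_of_degree k \<Lambda> m = {x. pdeg x = m \<and> pmor x \<in> extensional (Mor (Omega k m)) \<and>
     (\<exists>f. kgraph_morphism (Omega k m) \<Lambda> f (pmor x))}"

definition path_space :: "nat \<Rightarrow> ('o, 'm) kgraph \<Rightarrow> 'm kpath set" where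
  "path_space k \<Lambda> = (\<Union>m\<in>NNinf k. paths_of_degree k \<Lambda> m)"

definition inf_paths :: "nat \<Rightarrow> ('o, 'm) kgraph \<Rightarrow> 'm kpath set" where
  "inf_paths k \<Lambda> = paths_of_degree k \<Lambda> (infdeg k)"

text \<open>\<open>x(n) = x(n, n)\<close> regarded as an object; \<open>x(0)\<close> is \<open>r(x)\<close>.\<close>

definition pvert :: "('o, 'm) kgraph \<Rightarrow> 'm kpath \<Rightarrow> (nat \<Rightarrow> nat) \<Rightarrow> 'o" where
  "pvert \<Lambda> x n = rng \<Lambda> (pmor x (n, n))"

definition concat_path :: "nat \<Rightarrow> ('o, 'm) kgraph \<Rightarrow> 'm \<Rightarrow> 'm kpath \<Rightarrow> 'm kpath" where
  "concat_path k \<Lambda> \<mu> x = (THE y. y \<in> path_space k \<Lambda> \<and> pdeg y = fin (deg \<Lambda> \<mu>) + pdeg x \<and>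
     pmor y (0, deg \<Lambda> \<mu>) = \<mu> \<and>
     (\<forall>n\<in>NN k. fin n \<le> pdeg x \<longrightarrow> pmor y (deg \<Lambda> \<mu>, deg \<Lambda> \<mu> + n) = pmor x (0, n)))"

definition shift :: "nat \<Rightarrow> (nat \<Rightarrow> nat) \<Rightarrow> 'm kpath \<Rightarrow> 'm kpath" where
  "shift k n x = KPath (pdeg x - fin n)
     (restrict (\<lambda>(p, q). pmor x (p + n, q + n)) (Mor (Omega k (pdeg x - fin n))))"

definition restrict_path :: "nat \<Rightarrow> (nat \<Rightarrow> enat) \<Rightarrow> 'm kpath \<Rightarrow> 'm kpath" where
  "restrict_path k m x = KPath m (restrict (pmor x) (Mor (Omega k m)))"

definition exhaustive :: "('o, 'm) kgraph \<Rightarrow> 'o \<Rightarrow> 'm set \<Rightarrow> bool" where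
  "exhaustive \<Lambda> v E \<longleftrightarrow>
     E \<subseteq> paths_from \<Lambda> v \<and> (\<forall>\<mu>\<in>paths_from \<Lambda> v. \<exists>\<nu>\<in>E. MCE \<Lambda> \<nu> \<mu> \<noteq> {})"

definition FE :: "('o, 'm) kgraph \<Rightarrow> 'o \<Rightarrow> 'm set set" where
  "FE \<Lambda> v = {E. finite E \<and> exhaustive \<Lambda> v E}"

definition boundary_paths :: "nat \<Rightarrow> ('o, 'm) kgraph \<Rightarrow> 'm kpath set" where
  "boundary_paths k \<Lambda> = {x \<in> path_space k \<Lambda>.
     \<forall>n\<in>NN k. fin n \<le> pdeg x \<longrightarrow> (\<forall>E\<in>FE \<Lambda> (pvert \<Lambda> x n).
       \<exists>m\<in>NN k. n \<le> m \<and> fin m \<le> pdeg x \<and> pmor x (n, m) \<in> E)}"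

definition cylinder :: "nat \<Rightarrow> ('o, 'm) kgraph \<Rightarrow> 'm \<Rightarrow> 'm kpath set" where
  "cylinder k \<Lambda> \<mu> =
     {x \<in> path_space k \<Lambda>. fin (deg \<Lambda> \<mu>) \<le> pdeg x \<and> pmor x (0, deg \<Lambda> \<mu>) = \<mu>}"

definition cylinder_minus :: "nat \<Rightarrow> ('o, 'm) kgraph \<Rightarrow> 'm \<Rightarrow> 'm set \<Rightarrow> 'm kpath set" where
  "cylinder_minus k \<Lambda> \<mu> G = cylinder k \<Lambda> \<mu> - (\<Union>\<nu>\<in>G. cylinder k \<Lambda> (cmp \<Lambda> \<mu> \<nu>))"

definition path_topology :: "nat \<Rightarrow> ('o, 'm) kgraph \<Rightarrow> 'm kpath topology" where
  "path_topology k \<Lambda> = topology_generated_by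
     {cylinder_minus k \<Lambda> \<mu> G |\<mu> G. \<mu> \<in> Mor \<Lambda> \<and> finite G \<and> G \<subseteq> paths_from \<Lambda> (src \<Lambda> \<mu>)}"


section \<open>The desourcification\<close>

type_synonym 'm dobj = "('m kpath \<times> (nat \<Rightarrow> nat)) set"
type_synonym 'm dmor = "('m kpath \<times> (nat \<Rightarrow> nat) \<times> (nat \<Rightarrow> nat)) set"

definition obj_pairs :: "nat \<Rightarrow> ('o, 'm) kgraph \<Rightarrow> ('m kpath \<times> (nat \<Rightarrow> nat)) set" where
  "obj_pairs k \<Lambda> = boundary_paths k \<Lambda> \<times> NN k"

definition mor_pairs :: "nat \<Rightarrow> ('o, 'm) kgraph \<Rightarrow> ('m kpath \<times> (nat \<Rightarrow> nat) \<times> (nat \<Rightarrow> nat)) set" where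
  "mor_pairs k \<Lambda> = {(x, m, n). x \<in> boundary_paths k \<Lambda> \<and> m \<in> NN k \<and> n \<in> NN k \<and> m \<le> n}"

definition obj_rel ::
    "nat \<Rightarrow> ('o, 'm) kgraph \<Rightarrow> (('m kpath \<times> (nat \<Rightarrow> nat)) \<times> ('m kpath \<times> (nat \<Rightarrow> nat))) set" where
  "obj_rel k \<Lambda> = {((x, m), (y, p)). (x, m) \<in> obj_pairs k \<Lambda> \<and> (y, p) \<in> obj_pairs k \<Lambda> \<and>
     pvert \<Lambda> x (meetd m (pdeg x)) = pvert \<Lambda> y (meetd p (pdeg y)) \<and>
     m - meetd m (pdeg x) = p - meetd p (pdeg y)}"

definition mor_rel ::
    "nat \<Rightarrow> ('o, 'm) kgraph \<Rightarrow>
     (('m kpath \<times> (nat \<Rightarrow> nat) \<times> (nat \<Rightarrow> nat)) \<times> ('m kpath \<times> (nat \<Rightarrow> nat) \<times> (nat \<Rightarrow> nat))) set" where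
  "mor_rel k \<Lambda> = {((x, m, n), (y, p, q)). (x, m, n) \<in> mor_pairs k \<Lambda> \<and> (y, p, q) \<in> mor_pairs k \<Lambda> \<and>
     pmor x (meetd m (pdeg x), meetd n (pdeg x)) = pmor y (meetd p (pdeg y), meetd q (pdeg y)) \<and>
     m - meetd m (pdeg x) = p - meetd p (pdeg y) \<and>
     n - m = q - p}"

definition obj_class :: "nat \<Rightarrow> ('o, 'm) kgraph \<Rightarrow> 'm kpath \<Rightarrow> (nat \<Rightarrow> nat) \<Rightarrow> 'm dobj" where
  "obj_class k \<Lambda> x m = obj_rel k \<Lambda> `` {(x, m)}"

definition mor_class ::
    "nat \<Rightarrow> ('o, 'm) kgraph \<Rightarrow> 'm kpath \<Rightarrow> (nat \<Rightarrow> nat) \<Rightarrow> (nat \<Rightarrow> nat) \<Rightarrow> 'm dmor" where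
  "mor_class k \<Lambda> x m n = mor_rel k \<Lambda> `` {(x, m, n)}"

text \<open>
  Each structure map below is the value common to all choices of representatives of its arguments.
\<close>

definition desource :: "nat \<Rightarrow> ('o, 'm) kgraph \<Rightarrow> ('m dobj, 'm dmor) kgraph" where
  "desource k \<Lambda> =
    \<lparr>Obj = obj_pairs k \<Lambda> // obj_rel k \<Lambda>,
     Mor = mor_pairs k \<Lambda> // mor_rel k \<Lambda>,
     rng = (\<lambda>c. THE v. \<exists>x m n. (x, m, n) \<in> c \<and> v = obj_class k \<Lambda> x m),
     src = (\<lambda>c. THE v. \<exists>x m n. (x, m, n) \<in> c \<and> v = obj_class k \<Lambda> x n),
     idm = (\<lambda>v. THE c. \<exists>x m. (x, m) \<in> v \<and> c = mor_class k \<Lambda> x m m),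
     cmp = (\<lambda>c c'. THE e. \<exists>x m n y p q. (x, m, n) \<in> c \<and> (y, p, q) \<in> c' \<and>
              obj_class k \<Lambda> x n = obj_class k \<Lambda> y p \<and>
              e = mor_class k \<Lambda>
                    (concat_path k \<Lambda> (pmor x (0, meetd n (pdeg x))) (shift k (meetd p (pdeg y)) y))
                    m (n + q - p)),
     deg = (\<lambda>c. THE d. \<exists>x m n. (x, m, n) \<in> c \<and> d = n - m)\<rparr>"

definition iota :: "nat \<Rightarrow> ('o, 'm) kgraph \<Rightarrow> 'm \<Rightarrow> 'm dmor" where
  "iota k \<Lambda> \<mu> = (THE c. \<exists>x\<in>boundary_paths k \<Lambda>. pvert \<Lambda> x 0 = src \<Lambda> \<mu> \<and>
     c = mor_class k \<Lambda> (concat_path k \<Lambda> \<mu> x) 0 (deg \<Lambda> \<mu>))"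

definition iota_path :: "nat \<Rightarrow> ('o, 'm) kgraph \<Rightarrow> 'm kpath \<Rightarrow> 'm dmor kpath" where
  "iota_path k \<Lambda> x = KPath (pdeg x)
     (restrict (\<lambda>(p, q). iota k \<Lambda> (pmor x (p, q))) (Mor (Omega k (pdeg x))))"


section \<open>The map \<open>\<pi>\<close>\<close>

text \<open>\<open>\<iota>(\<Lambda>\<^sup>0)\<Lambda>\<^sup>\<infinity>\<close>, with \<open>\<Lambda>\<^sup>\<infinity>\<close> taken in the desourcification; \<open>r(x)\<close> is here the morphism \<open>x(0, 0)\<close>.\<close>

definition embedded_inf_paths :: "nat \<Rightarrow> ('o, 'm) kgraph \<Rightarrow> 'm dmor kpath set" where
  "embedded_inf_paths k \<Lambda> =
     {x \<in> inf_paths k (desource k \<Lambda>). pmor x (0, 0) \<in> iota k \<Lambda> ` vertices \<Lambda>}"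

definition proj_deg :: "nat \<Rightarrow> ('o, 'm) kgraph \<Rightarrow> 'm dmor kpath \<Rightarrow> nat \<Rightarrow> enat" where
  "proj_deg k \<Lambda> x = (SUP p \<in> {p \<in> NN k. pmor x (0, p) \<in> iota k \<Lambda> ` Mor \<Lambda>}. fin p)"

definition proj :: "nat \<Rightarrow> ('o, 'm) kgraph \<Rightarrow> 'm dmor kpath \<Rightarrow> 'm dmor kpath" where
  "proj k \<Lambda> x = restrict_path k (proj_deg k \<Lambda> x) x"

end

theory Submission
  imports Defs
begin

text \<open>
  Each \<open>z \<in> \<partial>\<Lambda>\<close> yields the infinite path \<open>(p, q) \<mapsto> [z;(p,q)]\<close> of the desourcification, and \<open>\<pi>\<close> sends it
  to \<open>\<iota>(z)\<close>, because \<open>[z;(0,p)] \<in> \<iota>(\<Lambda>)\<close> iff \<open>p \<le> d(z)\<close>. Every infinite path \<open>X\<close> with range in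
  \<open>\<iota>(\<Lambda>\<^sup>0)\<close> arises in this way: if \<open>X(0,p) = [y\<^sub>p;(0,p)]\<close>, then the paths \<open>y\<^sub>p(0, p \<and> d(y\<^sub>p))\<close> form a
  chain under extension, and their union \<open>z\<close> is a boundary path since a finite exhaustive set at a
  vertex of \<open>z\<close> is already met by some \<open>y\<^sub>p\<close> within degree \<open>p\<close>. As \<open>\<iota>\<close> is injective, \<open>\<pi>\<close> is bijective.

  Cylinder sets are clopen. The preimage of \<open>Z(A)\<close> under \<open>\<pi>\<close> is \<open>Z(A)\<close> if \<open>A \<in> \<iota>(\<Lambda>)\<close>, and empty
  otherwise, so \<open>\<pi>\<close> is continuous. Conversely \<open>[z;(0,p)] = [y;(0,p)]\<close> says that \<open>z\<close> extends
  \<open>\<lambda> = y(0, p \<and> d(y))\<close> but no \<open>\<lambda>\<alpha>\<close> with \<open>d(\<alpha>) = e\<^sub>i\<close> and \<open>d(\<lambda>)\<^sub>i < p\<^sub>i\<close>; by row-finiteness this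
  excludes only finitely many cylinders, so \<open>\<pi>\<^sup>-\<^sup>1\<close> is continuous.
\<close>

section \<open>Degrees\<close>

text \<open>A class [x;(m,n)] remembers only the part of the step that lies on x, the excess of m
  over d(x), and the length n - m. All work in the desourcification is done with this invariant,
  which splits each question into unique factorisation in \<Lambda> and coordinatewise arithmetic of
  the truncation of m at d(x). The difficulty is that representatives of one class may be boundary
  paths of different degrees. The truncated lengths are however visible in the class, so all
  representatives of X(0,p) that start at 0 are cut off at the same place. A positive excess records
  that the path stops in some direction; this negative information is why complements of cylinders
  appear in the continuity of the inverse. Boundary paths must also be plentiful, because \<iota>
  and the composition are defined by prolonging a finite path by a boundary path. Existence at each
  vertex is drawn from countability of \<Lambda>; that the prolonged path is again a boundary path
  is a second use of row-finiteness.\<close>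

lemma NN_zero [simp]: "0 \<in> NN k"
  by (simp add: NN_def)

lemma NN_add: "p \<in> NN k \<Longrightarrow> q \<in> NN k \<Longrightarrow> p + q \<in> NN k"
  by (simp add: NN_def)

lemma NN_mono: "q \<in> NN k \<Longrightarrow> p \<le> q \<Longrightarrow> p \<in> NN k"
  by (auto simp: NN_def le_fun_def) (metis le_zero_eq)

lemma NN_diff: "p \<in> NN k \<Longrightarrow> p - q \<in> NN k"
  by (simp add: NN_def)

lemma NN_sup: "p \<in> NN k \<Longrightarrow> q \<in> NN k \<Longrightarrow> sup p q \<in> NN k"
  by (simp add: NN_def)

lemma fun_zero_le [simp]: "(0 :: nat \<Rightarrow> nat) \<le> p"
  by (simp add: le_fun_def)

lemma fun_le_add [simp]: "(p :: nat \<Rightarrow> nat) \<le> p + q" "(q :: nat \<Rightarrow> nat) \<le> p + q"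
  by (simp_all add: le_fun_def)

lemma fun_add_diff_cancel [simp]: "(p + q) - (p :: nat \<Rightarrow> nat) = q"
  by (simp add: fun_eq_iff)

lemma fun_add_diff_le: "p \<le> q \<Longrightarrow> p + (q - p) = (q :: nat \<Rightarrow> nat)"
  by (simp add: fun_eq_iff le_fun_def)

lemma fin_le_iff [simp]: "fin p \<le> fin q \<longleftrightarrow> p \<le> q"
  by (simp add: fin_def le_fun_def)

lemma fin_le_trans: "p \<le> q \<Longrightarrow> fin q \<le> D \<Longrightarrow> fin p \<le> D"
  using fin_le_iff order_trans by blast

lemma fin_zero_le [simp]: "fin 0 \<le> D"
  by (simp add: fin_def le_fun_def zero_enat_def[symmetric])

lemma fin_sup_le: "fin p \<le> D \<Longrightarrow> fin q \<le> D \<Longrightarrow> fin (sup p q) \<le> D"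
  by (auto simp: fin_def le_fun_def sup_nat_def max_def)

lemma fin_NN_NNinf: "p \<in> NN k \<Longrightarrow> fin p \<in> NNinf k"
  by (simp add: NN_def NNinf_def fin_def zero_enat_def)

lemma NNinf_fin_le: "D \<in> NNinf k \<Longrightarrow> fin p \<le> D \<Longrightarrow> p \<in> NN k"
  by (auto simp: NN_def NNinf_def fin_def le_fun_def) (metis enat_0_iff(1) le_zero_eq)

lemma infdeg_NNinf [simp]: "infdeg k \<in> NNinf k"
  by (simp add: infdeg_def NNinf_def)

lemma fin_le_infdeg: "fin p \<le> infdeg k \<longleftrightarrow> p \<in> NN k"
  by (auto simp: fin_def infdeg_def NN_def le_fun_def zero_enat_def not_less)

section \<open>Arithmetic of truncation at a possibly infinite degree\<close>

lemma enat_meetd: "enat (meetd m D i) = min (enat (m i)) (D i)"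
  by (cases "D i") (auto simp: meetd_def min_def inf_enat_def)

lemma meetd_eq: "meetd m D i = (case D i of enat d \<Rightarrow> min (m i) d | \<infinity> \<Rightarrow> m i)"
  by (cases "D i") (auto simp: meetd_def min_def inf_enat_def)

lemma meetd_le: "meetd m D \<le> m"
  by (auto simp: le_fun_def meetd_eq split: enat.splits)

lemma fin_meetd_le: "fin (meetd m D) \<le> D"
  by (simp add: le_fun_def fin_def enat_meetd)

lemma meetd_mono: "m \<le> n \<Longrightarrow> meetd m D \<le> meetd n D"
  by (auto simp: le_fun_def meetd_eq min_le_iff_disj split: enat.splits)

lemma meetd_eq_self:
  assumes "fin m \<le> D"
  shows "meetd m D = m"
proof
  fix i
  have "enat (m i) \<le> D i"
    using assms by (simp add: fin_def le_fun_def)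
  then show "meetd m D i = m i"
    by (cases "D i") (auto simp: meetd_eq)
qed

lemma meetd_zero [simp]: "meetd 0 D = 0"
  by (simp add: meetd_eq_self)

text \<open>This is how a class reveals that its representative is not cut off: the excess
  vanishes.\<close>

lemma fin_le_if_meetd: "m - meetd m D = 0 \<Longrightarrow> fin m \<le> D"
proof -
  assume "m - meetd m D = 0"
  then have "m \<le> meetd m D"
    by (simp add: le_fun_def fun_eq_iff)
  then show ?thesis
    using fin_meetd_le fin_le_trans by blast
qed

text \<open>Truncated subtraction is left adjoint to addition. Bounds by the degree of a
  concatenation thereby become bounds by the degree of its tail.\<close>

lemma fin_le_add_iff: "fin p \<le> fin d + D \<longleftrightarrow> fin (p - d) \<le> D"
proof -
  have "enat a \<le> enat b + e \<longleftrightarrow> enat (a - b) \<le> e" for a b e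
    by (cases e) auto
  then show ?thesis
    by (simp add: le_fun_def fin_def)
qed

lemma le_meetd: "p \<le> m \<Longrightarrow> fin p \<le> D \<Longrightarrow> p \<le> meetd m D"
  using meetd_eq_self meetd_mono by metis

text \<open>Coordinatewise there are two cases. A positive excess at the start means that the degree
  is exhausted on both sides from the beginning. A zero excess means that the part of the step below
  the degree is min(n - m, D - m), and this number determines min(a, D - m) for every a \<le> n - m.
  So equal data for a whole step give equal data at all intermediate degrees.\<close>

lemma meetd_add_diff:
  assumes "m \<le> n" "p \<le> q" "m - meetd m D = p - meetd p D'" "n - m = q - p"
    and "meetd n D - meetd m D = meetd q D' - meetd p D'" "a \<le> n - m"
  shows "meetd (m + a) D - meetd m D = meetd (p + a) D' - meetd p D'"
    and "m + a - meetd (m + a) D = p + a - meetd (p + a) D'"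
    and "meetd (m + a) D \<le> meetd n D"
proof -
  have *: "meetd (m + a) D i - meetd m D i = meetd (p + a) D' i - meetd p D' i \<and>
      m i + a i - meetd (m + a) D i = p i + a i - meetd (p + a) D' i \<and>
      meetd (m + a) D i \<le> meetd n D i" for i
  proof -
    have "m i \<le> n i" "p i \<le> q i" "m i - meetd m D i = p i - meetd p D' i" "n i - m i = q i - p i"
      "meetd n D i - meetd m D i = meetd q D' i - meetd p D' i" "a i \<le> n i - m i"
      using assms by (auto simp: le_fun_def fun_eq_iff)
    then show ?thesis
      by (cases "D i"; cases "D' i") (auto simp: meetd_eq min_def split: if_splits)
  qed
  show "meetd (m + a) D - meetd m D = meetd (p + a) D' - meetd p D'"
    "m + a - meetd (m + a) D = p + a - meetd (p + a) D'" "meetd (m + a) D \<le> meetd n D"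
    using * by (auto simp: fun_eq_iff le_fun_def)
qed

text \<open>\<open>Z\<close> is the degree of the path that follows x up to the truncation of n and
  then y from the truncation of p. In a coordinate with positive excess both degrees are exhausted
  and \<open>Z\<close> equals \<open>D\<close>; in the others nothing is cut off at n or p, and
  \<open>Z\<close> is n plus what remains of \<open>D'\<close> after p.\<close>

lemma meetd_concat:
  assumes "n - meetd n D = p - meetd p D'" and "p \<le> q"
  defines "Z \<equiv> fin (meetd n D) + (D' - fin (meetd p D'))"
  shows "m \<le> n \<Longrightarrow> meetd m Z = meetd m D"
    and "meetd (n + (q - p)) Z = meetd n D + (meetd q D' - meetd p D')"
proof -
  show "meetd m Z = meetd m D" if "m \<le> n"
  proof
    fix i
    have "n i - meetd n D i = p i - meetd p D' i" "m i \<le> n i"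
      using assms(1) that by (auto simp: le_fun_def fun_eq_iff)
    then show "meetd m Z i = meetd m D i"
      by (cases "D i"; cases "D' i") (auto simp: Z_def fin_def meetd_eq min_def split: if_splits)
  qed
  show "meetd (n + (q - p)) Z = meetd n D + (meetd q D' - meetd p D')"
  proof
    fix i
    have "n i - meetd n D i = p i - meetd p D' i" "p i \<le> q i"
      using assms(1,2) by (auto simp: le_fun_def fun_eq_iff)
    then show "meetd (n + (q - p)) Z i = (meetd n D + (meetd q D' - meetd p D')) i"
      by (cases "D i"; cases "D' i") (auto simp: Z_def fin_def meetd_eq min_def split: if_splits)
  qed
qed

text \<open>Needed to identify p_x with d(z) when d(z) may have infinite coordinates.\<close>

lemma SUP_fin: "(SUP p \<in> {p. fin p \<le> D}. fin p) = D"
proof (rule order_antisym)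
  show "(SUP p \<in> {p. fin p \<le> D}. fin p) \<le> D"
    by (rule SUP_least) simp
  have "D i \<le> (SUP p \<in> {p. fin p \<le> D}. fin p) i" for i
  proof -
    have up: "enat n \<le> (SUP p \<in> {p. fin p \<le> D}. fin p) i" if "enat n \<le> D i" for n
    proof -
      \<comment> \<open>A degree concentrated in coordinate i lies below \<open>D\<close> as soon as
        its single entry does; an infinite entry of \<open>D\<close> is then exhausted by all finite
        n.\<close>
      let ?p = "\<lambda>i'. if i' = i then n else 0"
      have "fin ?p \<le> D"
        using that by (auto simp: fin_def le_fun_def zero_enat_def[symmetric])
      then have "fin ?p \<le> (SUP p \<in> {p. fin p \<le> D}. fin p)"
        by (intro SUP_upper) simp
      then have "fin ?p i \<le> (SUP p \<in> {p. fin p \<le> D}. fin p) i"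
        by (simp only: le_fun_def)
      then show ?thesis
        by (simp add: fin_def)
    qed
    show ?thesis
    proof (cases "D i")
      case (enat d)
      then show ?thesis
        using up by simp
    next
      case infinity
      then show ?thesis
        using up by (cases "(SUP p \<in> {p. fin p \<le> D}. fin p) i") (auto, metis Suc_n_not_le_n)
    qed
  qed
  then show "D \<le> (SUP p \<in> {p. fin p \<le> D}. fin p)"
    by (simp only: le_fun_def) simp
qed

section \<open>Paths\<close>

text \<open>Extension of paths as an order. Unique factorisation says that a path has exactly one
  prefix of each degree below its own, so chains and common extensions can replace explicit
  factorisations.\<close>

definition is_prefix :: "('o, 'm) kgraph \<Rightarrow> 'm \<Rightarrow> 'm \<Rightarrow> bool" where
  "is_prefix C \<mu> \<kappa> \<longleftrightarrow> \<mu> \<in> Mor C \<and> (\<exists>\<nu>\<in>Mor C. src C \<mu> = rng C \<nu> \<and> \<kappa> = cmp C \<mu> \<nu>)"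

lemma path_spaceI:
  assumes "D \<in> NNinf k" "F \<in> extensional (Mor (Omega k D))"
    and "\<And>p. fin p \<le> D \<Longrightarrow> f p \<in> Obj C \<and> F (p, p) = idm C (f p)"
    and "\<And>p q. p \<le> q \<Longrightarrow> fin q \<le> D \<Longrightarrow> F (p, q) \<in> Mor C \<and> rng C (F (p, q)) = f p \<and>
           src C (F (p, q)) = f q \<and> deg C (F (p, q)) = q - p"
    and "\<And>p q t. p \<le> q \<Longrightarrow> q \<le> t \<Longrightarrow> fin t \<le> D \<Longrightarrow> cmp C (F (p, q)) (F (q, t)) = F (p, t)"
  shows "KPath D F \<in> path_space k C"
proof -
  have "kgraph_morphism (Omega k D) C f F"
    using assms(3-5) by (auto simp: kgraph_morphism_def Omega_def)
  then show ?thesis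
    using assms(1,2) by (auto simp: path_space_def paths_of_degree_def)
qed

lemma pdeg_NNinf: "x \<in> path_space k C \<Longrightarrow> pdeg x \<in> NNinf k"
  by (auto simp: path_space_def paths_of_degree_def)

lemma fin_le_pdeg_NN: "x \<in> path_space k C \<Longrightarrow> fin p \<le> pdeg x \<Longrightarrow> p \<in> NN k"
  using NNinf_fin_le pdeg_NNinf by blast

text \<open>The object part of a path is only asserted to exist. Looking at the range of x(n,n)
  shows that it must be \<open>pvert\<close>, which takes its place from here on.\<close>

lemma path_morphism:
  assumes "x \<in> path_space k C" "p \<le> q" "fin q \<le> pdeg x"
  shows "pmor x (p, q) \<in> Mor C"
    and "deg C (pmor x (p, q)) = q - p"
    and "rng C (pmor x (p, q)) = pvert C x p"
    and "src C (pmor x (p, q)) = pvert C x q"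
    and "pmor x (p, p) = idm C (pvert C x p)"
    and "pvert C x p \<in> Obj C"
proof -
  obtain f where f: "kgraph_morphism (Omega k (pdeg x)) C f (pmor x)"
    using assms(1) by (auto simp: path_space_def paths_of_degree_def)
  have pq: "p \<in> NN k" "q \<in> NN k" "fin p \<le> pdeg x"
    using fin_le_pdeg_NN[OF assms(1)] fin_le_trans[OF assms(2,3)] assms(3) by blast+
  have *: "pmor x (a, b) \<in> Mor C \<and> rng C (pmor x (a, b)) = f a \<and> src C (pmor x (a, b)) = f b \<and>
      deg C (pmor x (a, b)) = b - a" if "a \<in> NN k" "b \<in> NN k" "a \<le> b" "fin b \<le> pdeg x" for a b
  proof -
    have "\<forall>\<mu>\<in>Mor (Omega k (pdeg x)). pmor x \<mu> \<in> Mor C \<and> rng C (pmor x \<mu>) = f (rng (Omega k (pdeg x)) \<mu>) \<and>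
        src C (pmor x \<mu>) = f (src (Omega k (pdeg x)) \<mu>) \<and> deg C (pmor x \<mu>) = deg (Omega k (pdeg x)) \<mu>"
      using f unfolding kgraph_morphism_def by blast
    moreover have "(a, b) \<in> Mor (Omega k (pdeg x))"
      using that by (simp add: Omega_def)
    ultimately show ?thesis
      by (auto simp: Omega_def dest: bspec)
  qed
  have **: "pvert C x a = f a" if "a \<in> NN k" "fin a \<le> pdeg x" for a
    using *[OF that(1) that(1) _ that(2)] by (simp add: pvert_def)
  show "pmor x (p, q) \<in> Mor C" "deg C (pmor x (p, q)) = q - p"
    "rng C (pmor x (p, q)) = pvert C x p" "src C (pmor x (p, q)) = pvert C x q"
    using *[of p q] ** pq assms by auto
  show "pmor x (p, p) = idm C (pvert C x p)" and "pvert C x p \<in> Obj C"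
  proof -
    have "\<forall>v\<in>Obj (Omega k (pdeg x)). f v \<in> Obj C \<and> pmor x (idm (Omega k (pdeg x)) v) = idm C (f v)"
      using f unfolding kgraph_morphism_def by blast
    moreover have "p \<in> Obj (Omega k (pdeg x))"
      using pq by (simp add: Omega_def)
    ultimately have "f p \<in> Obj C" "pmor x (p, p) = idm C (f p)"
      by (auto simp: Omega_def dest: bspec)
    then show "pmor x (p, p) = idm C (pvert C x p)" "pvert C x p \<in> Obj C"
      using **[OF pq(1,3)] by simp_all
  qed
qed

lemma path_cmp:
  assumes "x \<in> path_space k C" "p \<le> q" "q \<le> t" "fin t \<le> pdeg x"
  shows "cmp C (pmor x (p, q)) (pmor x (q, t)) = pmor x (p, t)"
proof -
  obtain f where f: "kgraph_morphism (Omega k (pdeg x)) C f (pmor x)"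
    using assms(1) by (auto simp: path_space_def paths_of_degree_def)
  have pq: "p \<in> NN k" "q \<in> NN k" "t \<in> NN k" "fin q \<le> pdeg x"
    using fin_le_pdeg_NN[OF assms(1)] fin_le_trans[OF assms(3,4)]
      fin_le_trans[OF order_trans[OF assms(2,3)] assms(4)] assms(4) by blast+
  have *: "\<forall>\<mu>\<in>Mor (Omega k (pdeg x)). \<forall>\<nu>\<in>Mor (Omega k (pdeg x)). src (Omega k (pdeg x)) \<mu> = rng (Omega k (pdeg x)) \<nu> \<longrightarrow>
      pmor x (cmp (Omega k (pdeg x)) \<mu> \<nu>) = cmp C (pmor x \<mu>) (pmor x \<nu>)"
    using f unfolding kgraph_morphism_def by blast
  have "(p, q) \<in> Mor (Omega k (pdeg x))" "(q, t) \<in> Mor (Omega k (pdeg x))"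
    using pq assms by (auto simp: Omega_def)
  from *[rule_format, OF this] show ?thesis
    by (simp add: Omega_def)
qed

lemma pmor_extensional: "x \<in> path_space k C \<Longrightarrow> pmor x \<in> extensional (Mor (Omega k (pdeg x)))"
  by (auto simp: path_space_def paths_of_degree_def)

lemma path_eqI:
  assumes "x \<in> path_space k C" "y \<in> path_space k C'" "pdeg x = pdeg y"
    and "\<And>p q. p \<le> q \<Longrightarrow> fin q \<le> pdeg x \<Longrightarrow> pmor x (p, q) = pmor y (p, q)"
  shows "x = y"
proof -
  have "pmor x = pmor y"
  proof (rule extensionalityI)
    show "pmor x \<in> extensional (Mor (Omega k (pdeg x)))" "pmor y \<in> extensional (Mor (Omega k (pdeg x)))"
      using pmor_extensional assms(1,2,3) by metis+
  qed (use assms(4) in \<open>auto simp: Omega_def\<close>)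
  then show ?thesis
    using assms(3) by (simp add: kpath.expand)
qed

lemma path_prefix:
  assumes "x \<in> path_space k C" "p \<le> q" "q \<le> t" "fin t \<le> pdeg x"
  shows "is_prefix C (pmor x (p, q)) (pmor x (p, t))"
proof -
  have "fin q \<le> pdeg x"
    using fin_le_trans[OF assms(3,4)] .
  then show ?thesis
    using path_cmp[OF assms] path_morphism(1,4)[OF assms(1,2)] path_morphism(1,3)[OF assms(1,3,4)]
    unfolding is_prefix_def by (auto intro!: bexI[of _ "pmor x (q, t)"])
qed

text \<open>Subtraction of extended naturals is truncated; the bound n \<le> d(x) is what makes p
  \<le> d(x) - n equivalent to p + n \<le> d(x). The rest is translation by n.\<close>

lemma shift_path:
  assumes "x \<in> path_space k C" "fin n \<le> pdeg x"
  shows "shift k n x \<in> path_space k C"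
    and "pdeg (shift k n x) = pdeg x - fin n"
    and "\<And>p. fin p \<le> pdeg x - fin n \<longleftrightarrow> fin (p + n) \<le> pdeg x"
    and "\<And>p q. p \<le> q \<Longrightarrow> fin (q + n) \<le> pdeg x \<Longrightarrow> pmor (shift k n x) (p, q) = pmor x (p + n, q + n)"
    and "\<And>p. fin (p + n) \<le> pdeg x \<Longrightarrow> pvert C (shift k n x) p = pvert C x (p + n)"
proof -
  show le: "fin p \<le> pdeg x - fin n \<longleftrightarrow> fin (p + n) \<le> pdeg x" for p
  proof -
    have "enat (p i) \<le> pdeg x i - enat (n i) \<longleftrightarrow> enat (p i + n i) \<le> pdeg x i" for i
    proof -
      have "enat (n i) \<le> pdeg x i"
        using assms(2) by (simp add: le_fun_def fin_def)
      then show ?thesis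
        by (cases "pdeg x i") auto
    qed
    then show ?thesis
      by (simp add: le_fun_def fin_def)
  qed
  show deg: "pdeg (shift k n x) = pdeg x - fin n"
    by (simp add: shift_def)
  have inf: "pdeg x - fin n \<in> NNinf k"
    using pdeg_NNinf[OF assms(1)] by (simp add: NNinf_def)
  show pm: "pmor (shift k n x) (p, q) = pmor x (p + n, q + n)"
    if "p \<le> q" "fin (q + n) \<le> pdeg x" for p q
  proof -
    have "q \<in> NN k" "p \<in> NN k"
      using NNinf_fin_le[OF inf] le that NN_mono by blast+
    then show ?thesis
      using that le by (simp add: shift_def Omega_def)
  qed
  then show "pvert C (shift k n x) p = pvert C x (p + n)" if "fin (p + n) \<le> pdeg x" for p
    using that by (simp add: pvert_def)
  have mono: "p + n \<le> q + n" if "p \<le> q" for p q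
    using that by (simp add: le_fun_def)
  have "KPath (pdeg (shift k n x)) (pmor (shift k n x)) \<in> path_space k C"
  proof (rule path_spaceI)
    show "pdeg (shift k n x) \<in> NNinf k"
      using deg inf by simp
    show "pmor (shift k n x) \<in> extensional (Mor (Omega k (pdeg (shift k n x))))"
      by (simp add: shift_def)
    show "pvert C x (p + n) \<in> Obj C \<and> pmor (shift k n x) (p, p) = idm C (pvert C x (p + n))"
      if "fin p \<le> pdeg (shift k n x)" for p
    proof -
      have "fin (p + n) \<le> pdeg x"
        using that deg le by simp
      then show ?thesis
        using path_morphism[OF assms(1), of "p + n" "p + n"] pm[of p p] by simp
    qed
    show "pmor (shift k n x) (p, q) \<in> Mor C \<and> rng C (pmor (shift k n x) (p, q)) = pvert C x (p + n) \<and>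
        src C (pmor (shift k n x) (p, q)) = pvert C x (q + n) \<and> deg C (pmor (shift k n x) (p, q)) = q - p"
      if "p \<le> q" "fin q \<le> pdeg (shift k n x)" for p q
    proof -
      have *: "fin (q + n) \<le> pdeg x"
        using that deg le by simp
      have "q + n - (p + n) = q - p"
        by (simp add: fun_eq_iff)
      then show ?thesis
        using path_morphism[OF assms(1) mono[OF that(1)] *] pm[OF that(1) *] by simp
    qed
    show "cmp C (pmor (shift k n x) (p, q)) (pmor (shift k n x) (q, t)) = pmor (shift k n x) (p, t)"
      if "p \<le> q" "q \<le> t" "fin t \<le> pdeg (shift k n x)" for p q t
    proof -
      have *: "fin (t + n) \<le> pdeg x"
        using that deg le by simp
      then have "fin (q + n) \<le> pdeg x"
        using mono[OF that(2)] fin_le_trans by blast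
      then show ?thesis
        using path_cmp[OF assms(1) mono[OF that(1)] mono[OF that(2)] *] * pm that by simp
    qed
  qed
  then show "shift k n x \<in> path_space k C"
    by simp
qed

lemma restrict_path:
  assumes "x \<in> path_space k C" "D \<in> NNinf k" "D \<le> pdeg x"
  shows "restrict_path k D x \<in> path_space k C"
    and "\<And>p q. p \<le> q \<Longrightarrow> fin q \<le> D \<Longrightarrow> pmor (restrict_path k D x) (p, q) = pmor x (p, q)"
proof -
  show pm: "pmor (restrict_path k D x) (p, q) = pmor x (p, q)" if "p \<le> q" "fin q \<le> D" for p q
  proof -
    have "q \<in> NN k" "p \<in> NN k"
      using NNinf_fin_le[OF assms(2)] that NN_mono by blast+
    then show ?thesis
      using that by (simp add: restrict_path_def Omega_def)
  qed
  have le: "fin p \<le> pdeg x" if "fin p \<le> D" for p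
    using that assms(3) by (rule order_trans)
  show "restrict_path k D x \<in> path_space k C"
    unfolding restrict_path_def
  proof (rule path_spaceI[where f = "pvert C x"])
    show "restrict (pmor x) (Mor (Omega k D)) \<in> extensional (Mor (Omega k D))"
      by simp
    have eq: "restrict (pmor x) (Mor (Omega k D)) (p, q) = pmor x (p, q)" if "p \<le> q" "fin q \<le> D" for p q
      using pm[OF that] by (simp add: restrict_path_def)
    show "pvert C x p \<in> Obj C \<and> restrict (pmor x) (Mor (Omega k D)) (p, p) = idm C (pvert C x p)"
      if "fin p \<le> D" for p
      using path_morphism[OF assms(1) _ le[OF that], of p] eq[OF _ that, of p] by simp
    show "restrict (pmor x) (Mor (Omega k D)) (p, q) \<in> Mor C \<and>
        rng C (restrict (pmor x) (Mor (Omega k D)) (p, q)) = pvert C x p \<and>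
        src C (restrict (pmor x) (Mor (Omega k D)) (p, q)) = pvert C x q \<and>
        deg C (restrict (pmor x) (Mor (Omega k D)) (p, q)) = q - p"
      if "p \<le> q" "fin q \<le> D" for p q
      using path_morphism[OF assms(1) that(1) le[OF that(2)]] eq[OF that] by simp
    show "cmp C (restrict (pmor x) (Mor (Omega k D)) (p, q))
        (restrict (pmor x) (Mor (Omega k D)) (q, t)) = restrict (pmor x) (Mor (Omega k D)) (p, t)"
      if "p \<le> q" "q \<le> t" "fin t \<le> D" for p q t
    proof -
      have "fin q \<le> D"
        using fin_le_trans[OF that(2,3)] .
      then show ?thesis
        using path_cmp[OF assms(1) that(1,2) le[OF that(3)]] eq[OF that(1)] eq[OF that(2,3)]
          eq[OF order_trans[OF that(1,2)] that(3)] by simp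
    qed
  qed (use assms in auto)
qed

section \<open>Prefixes in a \<open>k\<close>-graph\<close>

context k_graph
begin

text \<open>It is enough to compare the degrees of the first factors: degrees add and cancel, so the
  second factors then have equal degree too.\<close>

lemma factor_unique:
  assumes "a \<in> Mor \<Lambda>" "b \<in> Mor \<Lambda>" "src \<Lambda> a = rng \<Lambda> b"
    and "a' \<in> Mor \<Lambda>" "b' \<in> Mor \<Lambda>" "src \<Lambda> a' = rng \<Lambda> b'"
    and "cmp \<Lambda> a b = cmp \<Lambda> a' b'" "deg \<Lambda> a = deg \<Lambda> a'"
  shows "a = a'" "b = b'"
proof -
  have d: "deg \<Lambda> (cmp \<Lambda> a b) = deg \<Lambda> a + deg \<Lambda> b" "deg \<Lambda> (cmp \<Lambda> a b) = deg \<Lambda> a' + deg \<Lambda> b'"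
    using assms deg_cmp by metis+
  then have db: "deg \<Lambda> b' = deg \<Lambda> b"
    using assms(8) by (simp add: fun_eq_iff)
  have "\<exists>!(\<mu>, \<nu>). \<mu> \<in> Mor \<Lambda> \<and> \<nu> \<in> Mor \<Lambda> \<and> src \<Lambda> \<mu> = rng \<Lambda> \<nu> \<and> cmp \<Lambda> a b = cmp \<Lambda> \<mu> \<nu> \<and>
        deg \<Lambda> \<mu> = deg \<Lambda> a \<and> deg \<Lambda> \<nu> = deg \<Lambda> b"
    by (rule factorisation) (use assms deg_NN cmp_Mor d in auto)
  then have "(a, b) = (a', b')"
    by (rule ex1E) (use assms db in \<open>auto dest: spec\<close>)
  then show "a = a'" "b = b'"
    by auto
qed

text \<open>Multiplying \<open>\<mu>\<close> by an identity on the right or on the left gives two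
  factorisations of \<open>\<mu>\<close> whose first factors both have degree 0.\<close>

lemma deg_zero_idm:
  assumes "\<mu> \<in> Mor \<Lambda>" "deg \<Lambda> \<mu> = 0"
  shows "\<mu> = idm \<Lambda> (rng \<Lambda> \<mu>)" "src \<Lambda> \<mu> = rng \<Lambda> \<mu>"
proof -
  have o: "rng \<Lambda> \<mu> \<in> Obj \<Lambda>" "src \<Lambda> \<mu> \<in> Obj \<Lambda>"
    using assms rng_Obj src_Obj by auto
  show *: "\<mu> = idm \<Lambda> (rng \<Lambda> \<mu>)"
    by (rule factor_unique(1)[of \<mu> "idm \<Lambda> (src \<Lambda> \<mu>)" _ \<mu>])
      (use assms o idm_Mor rng_idm src_idm cmp_idm_left cmp_idm_right deg_idm in auto)
  show "src \<Lambda> \<mu> = rng \<Lambda> \<mu>"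
    using o src_idm * by metis
qed

abbreviation pre :: "'m \<Rightarrow> 'm \<Rightarrow> bool" where
  "pre \<equiv> is_prefix \<Lambda>"

lemma pre_cmpI: "\<mu> \<in> Mor \<Lambda> \<Longrightarrow> \<nu> \<in> Mor \<Lambda> \<Longrightarrow> src \<Lambda> \<mu> = rng \<Lambda> \<nu> \<Longrightarrow> pre \<mu> (cmp \<Lambda> \<mu> \<nu>)"
  by (auto simp: is_prefix_def)

lemma preD:
  assumes "pre a b"
  shows "a \<in> Mor \<Lambda>" "b \<in> Mor \<Lambda>" "rng \<Lambda> b = rng \<Lambda> a" "deg \<Lambda> a \<le> deg \<Lambda> b"
  using assms by (auto simp: is_prefix_def cmp_Mor rng_cmp deg_cmp)

lemma pre_refl: "a \<in> Mor \<Lambda> \<Longrightarrow> pre a a"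
  using cmp_idm_right[of a] idm_Mor[OF src_Obj] rng_idm[OF src_Obj] unfolding is_prefix_def by metis

lemma pre_trans: "pre a b \<Longrightarrow> pre b c \<Longrightarrow> pre a c"
  by (clarsimp simp: is_prefix_def src_cmp cmp_assoc) (metis cmp_Mor rng_cmp)

lemma pre_unique:
  assumes "pre a c" "pre b c" "deg \<Lambda> a = deg \<Lambda> b"
  shows "a = b"
  using assms factor_unique(1) unfolding is_prefix_def by metis

lemma pre_exists:
  assumes "c \<in> Mor \<Lambda>" "p \<le> deg \<Lambda> c"
  shows "\<exists>a. pre a c \<and> deg \<Lambda> a = p"
proof -
  have "p \<in> NN k" "deg \<Lambda> c - p \<in> NN k"
    using deg_NN[OF assms(1)] NN_mono[OF _ assms(2)] NN_diff by auto
  moreover have "deg \<Lambda> c = p + (deg \<Lambda> c - p)"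
    using fun_add_diff_le[OF assms(2)] by simp
  ultimately show ?thesis
    using ex1_implies_ex[OF factorisation[OF assms(1)]] by (fastforce simp: is_prefix_def)
qed

text \<open>The prefix of \<open>b\<close> of degree d(a) is also a prefix of \<open>c\<close>,
  hence equal to \<open>a\<close>.\<close>

lemma pre_linear:
  assumes "pre a c" "pre b c" "deg \<Lambda> a \<le> deg \<Lambda> b"
  shows "pre a b"
proof -
  obtain a' where "pre a' b" "deg \<Lambda> a' = deg \<Lambda> a"
    using pre_exists[OF preD(1)[OF assms(2)] assms(3)] by blast
  then show ?thesis
    using pre_unique pre_trans assms by metis
qed

lemma pre_eq: "pre a b \<Longrightarrow> deg \<Lambda> a = deg \<Lambda> b \<Longrightarrow> a = b"
  using pre_unique pre_refl preD(2) by metis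

lemma pre_cmp_mono:
  assumes "pre a b" "\<mu> \<in> Mor \<Lambda>" "src \<Lambda> \<mu> = rng \<Lambda> a"
  shows "pre (cmp \<Lambda> \<mu> a) (cmp \<Lambda> \<mu> b)"
  using assms by (auto simp: is_prefix_def cmp_Mor cmp_assoc[symmetric] src_cmp)

lemma pre_cmp_cancel:
  assumes "pre (cmp \<Lambda> \<mu> a) (cmp \<Lambda> \<mu> b)" "\<mu> \<in> Mor \<Lambda>" "a \<in> Mor \<Lambda>" "b \<in> Mor \<Lambda>"
    and "src \<Lambda> \<mu> = rng \<Lambda> a" "src \<Lambda> \<mu> = rng \<Lambda> b"
  shows "pre a b"
proof -
  obtain \<nu> where n: "\<nu> \<in> Mor \<Lambda>" "src \<Lambda> a = rng \<Lambda> \<nu>" "cmp \<Lambda> \<mu> b = cmp \<Lambda> \<mu> (cmp \<Lambda> a \<nu>)"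
    using assms by (auto simp: is_prefix_def src_cmp cmp_assoc)
  have "b = cmp \<Lambda> a \<nu>"
    by (rule factor_unique(2)[of \<mu> b \<mu>]) (use n assms in \<open>auto simp: cmp_Mor rng_cmp\<close>)
  then show ?thesis
    using n assms by (auto simp: is_prefix_def)
qed

lemma MCE_iff: "c \<in> MCE \<Lambda> a b \<longleftrightarrow> pre a c \<and> pre b c \<and> deg \<Lambda> c = sup (deg \<Lambda> a) (deg \<Lambda> b)"
  if "a \<in> Mor \<Lambda>" "b \<in> Mor \<Lambda>"
  using that by (auto simp: MCE_def is_prefix_def cmp_Mor)

text \<open>Cut \<open>t\<close> at the join of the two degrees. Having a minimal common extension
  is therefore the same as having any common extension.\<close>

lemma MCE_below:
  assumes "pre a t" "pre b t"
  obtains c where "c \<in> MCE \<Lambda> a b" "pre c t"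
proof -
  have le: "sup (deg \<Lambda> a) (deg \<Lambda> b) \<le> deg \<Lambda> t"
    using assms preD by simp
  obtain c where c: "pre c t" "deg \<Lambda> c = sup (deg \<Lambda> a) (deg \<Lambda> b)"
    using pre_exists[OF preD(2)[OF assms(1)] le] by blast
  have "pre a c" "pre b c"
    using pre_linear[OF assms(1) c(1)] pre_linear[OF assms(2) c(1)] c(2) by auto
  then have "c \<in> MCE \<Lambda> a b"
    using c MCE_iff assms preD(1) by blast
  then show thesis
    using that c by blast
qed

section \<open>Construction of paths\<close>

text \<open>A path can be given by its initial segments alone: \<open>T p q\<close> is what remains
  of \<open>L q\<close> after \<open>L p\<close>, and functoriality of \<open>T\<close> follows by
  cancelling \<open>L p\<close> on the left.\<close>

lemma path_of_prefixes:
  assumes D: "D \<in> NNinf k"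
    and L: "\<And>p. fin p \<le> D \<Longrightarrow> deg \<Lambda> (L p) = p"
    and pre: "\<And>p q. p \<le> q \<Longrightarrow> fin q \<le> D \<Longrightarrow> pre (L p) (L q)"
  shows "\<exists>x\<in>path_space k \<Lambda>. pdeg x = D \<and> (\<forall>p. fin p \<le> D \<longrightarrow> pmor x (0, p) = L p)"
proof -
  define T where "T p q = (SOME \<nu>. \<nu> \<in> Mor \<Lambda> \<and> src \<Lambda> (L p) = rng \<Lambda> \<nu> \<and> L q = cmp \<Lambda> (L p) \<nu>)" for p q
  have T: "T p q \<in> Mor \<Lambda>" "rng \<Lambda> (T p q) = src \<Lambda> (L p)" "cmp \<Lambda> (L p) (T p q) = L q"
    if "p \<le> q" "fin q \<le> D" for p q
  proof -
    have "\<exists>\<nu>. \<nu> \<in> Mor \<Lambda> \<and> src \<Lambda> (L p) = rng \<Lambda> \<nu> \<and> L q = cmp \<Lambda> (L p) \<nu>"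
      using pre[OF that] by (auto simp: is_prefix_def)
    from someI_ex[OF this] show "T p q \<in> Mor \<Lambda>" "rng \<Lambda> (T p q) = src \<Lambda> (L p)"
      "cmp \<Lambda> (L p) (T p q) = L q"
      unfolding T_def by simp_all
  qed
  have LM: "L p \<in> Mor \<Lambda>" if "fin p \<le> D" for p
    using pre[of p p] that preD by blast
  have Tsrc: "src \<Lambda> (T p q) = src \<Lambda> (L q)" if "p \<le> q" "fin q \<le> D" for p q
    using src_cmp[OF LM T(1)] T that fin_le_trans by metis
  have Tdeg: "deg \<Lambda> (T p q) = q - p" if "p \<le> q" "fin q \<le> D" for p q
  proof -
    have "deg \<Lambda> (L q) = deg \<Lambda> (L p) + deg \<Lambda> (T p q)"
      using deg_cmp[OF LM T(1)] T that fin_le_trans by metis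
    then have "q = p + deg \<Lambda> (T p q)"
      using L that fin_le_trans by metis
    then show ?thesis
      by (metis fun_add_diff_cancel)
  qed
  define F where "F = restrict (\<lambda>(p, q). T p q) (Mor (Omega k D))"
  have F: "F (p, q) = T p q" if "p \<le> q" "fin q \<le> D" for p q
  proof -
    have "q \<in> NN k" "p \<in> NN k"
      using NNinf_fin_le[OF D] that NN_mono by blast+
    then show ?thesis
      using that by (simp add: F_def Omega_def)
  qed
  have "KPath D F \<in> path_space k \<Lambda>"
  proof (rule path_spaceI[OF D, where f = "\<lambda>p. src \<Lambda> (L p)"])
    show "F \<in> extensional (Mor (Omega k D))"
      by (simp add: F_def)
    show "src \<Lambda> (L p) \<in> Obj \<Lambda> \<and> F (p, p) = idm \<Lambda> (src \<Lambda> (L p))" if "fin p \<le> D" for p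
    proof -
      have "deg \<Lambda> (T p p) = 0"
        using Tdeg[of p p] that by (simp add: fun_eq_iff)
      then have "T p p = idm \<Lambda> (src \<Lambda> (L p))"
        using deg_zero_idm(1)[OF T(1)] T(2) that by (metis order_refl)
      then show ?thesis
        using that F LM src_Obj by simp
    qed
    show "F (p, q) \<in> Mor \<Lambda> \<and> rng \<Lambda> (F (p, q)) = src \<Lambda> (L p) \<and> src \<Lambda> (F (p, q)) = src \<Lambda> (L q) \<and>
        deg \<Lambda> (F (p, q)) = q - p" if "p \<le> q" "fin q \<le> D" for p q
      using that F T Tsrc Tdeg by simp
    show "cmp \<Lambda> (F (p, q)) (F (q, t)) = F (p, t)" if "p \<le> q" "q \<le> t" "fin t \<le> D" for p q t
    proof -
      have fl: "fin p \<le> D" "fin q \<le> D" and pt: "p \<le> t"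
        using that fin_le_trans order_trans by blast+
      note pq = T[OF that(1) fl(2)] and qt = T[OF that(2,3)] and pt' = T[OF pt that(3)]
      have c: "src \<Lambda> (T p q) = rng \<Lambda> (T q t)"
        using Tsrc[OF that(1) fl(2)] qt by simp
      have "cmp \<Lambda> (L p) (cmp \<Lambda> (T p q) (T q t)) = cmp \<Lambda> (L p) (T p t)"
        using cmp_assoc[OF LM[OF fl(1)] pq(1) qt(1)] c pq qt pt' by simp
      then have "cmp \<Lambda> (T p q) (T q t) = T p t"
        by (rule factor_unique(2)[rotated 6])
          (use LM[OF fl(1)] pq qt pt' c in \<open>auto simp: cmp_Mor rng_cmp\<close>)
      then show ?thesis
        using F that fl pt by simp
    qed
  qed
  moreover have "F (0, p) = L p" if "fin p \<le> D" for p
  proof -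
    have z: "L 0 = idm \<Lambda> (src \<Lambda> (L 0))"
      using deg_zero_idm[OF LM] L fin_zero_le by metis
    have "L p = cmp \<Lambda> (idm \<Lambda> (rng \<Lambda> (T 0 p))) (T 0 p)"
      using T[of 0 p] that z by simp
    then show ?thesis
      using cmp_idm_left T(1)[of 0 p] F[of 0 p] that by simp
  qed
  ultimately show ?thesis
    by (auto intro!: bexI[of _ "KPath D F"])
qed

lemma path_pre_from:
  assumes "x \<in> path_space k \<Lambda>" "p \<le> q" "fin q \<le> pdeg x" "pre a (pmor x (p, q))"
  shows "p + deg \<Lambda> a \<le> q" "a = pmor x (p, p + deg \<Lambda> a)"
proof -
  note x = path_morphism[OF assms(1)]
  have "deg \<Lambda> a \<le> q - p"
    using preD(4)[OF assms(4)] x(2)[OF assms(2,3)] by simp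
  then have "p + deg \<Lambda> a \<le> p + (q - p)"
    by (simp add: le_fun_def)
  then show le: "p + deg \<Lambda> a \<le> q"
    using fun_add_diff_le[OF assms(2)] by simp
  have "deg \<Lambda> (pmor x (p, p + deg \<Lambda> a)) = deg \<Lambda> a"
    using x(2)[OF fun_le_add(1) fin_le_trans[OF le assms(3)]] by simp
  then show "a = pmor x (p, p + deg \<Lambda> a)"
    using pre_unique[OF assms(4) path_prefix[OF assms(1) fun_le_add(1) le assms(3)]] by simp
qed

lemma path_pre:
  assumes "x \<in> path_space k \<Lambda>" "fin q \<le> pdeg x" "pre a (pmor x (0, q))"
  shows "deg \<Lambda> a \<le> q" "a = pmor x (0, deg \<Lambda> a)"
  using path_pre_from[OF assms(1) fun_zero_le assms(2,3)] by simp_all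

lemma path_cmpD:
  assumes "x \<in> path_space k \<Lambda>" "p \<le> n" "fin (n + deg \<Lambda> \<nu>) \<le> pdeg x" "\<nu> \<in> Mor \<Lambda>"
    and "rng \<Lambda> \<nu> = pvert \<Lambda> x n" "pmor x (p, n + deg \<Lambda> \<nu>) = cmp \<Lambda> (pmor x (p, n)) \<nu>"
  shows "pmor x (n, n + deg \<Lambda> \<nu>) = \<nu>"
proof -
  have fn: "fin n \<le> pdeg x"
    using fin_le_trans[OF fun_le_add(1) assms(3)] .
  note x1 = path_morphism[OF assms(1,2) fn] and x2 = path_morphism[OF assms(1) fun_le_add(1) assms(3)]
  show ?thesis
    by (rule factor_unique(2)[of "pmor x (p, n)" _ "pmor x (p, n)"])
      (use x1 x2 assms path_cmp[OF assms(1,2) fun_le_add(1) assms(3)] in auto)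
qed

text \<open>The starting degrees \<open>c\<close> and \<open>e\<close> may differ, as they do for
  two representatives of one class. Segments from the left end agree because they are prefixes of a
  common path; cancelling them gives the inner segments.\<close>

lemma path_agree:
  assumes x: "x \<in> path_space k \<Lambda>" "fin (c + N) \<le> pdeg x"
    and y: "y \<in> path_space k \<Lambda>" "fin (e + N) \<le> pdeg y"
    and eq: "pmor x (c, c + N) = pmor y (e, e + N)" and ab: "a \<le> b" "b \<le> N"
  shows "pmor x (c + a, c + b) = pmor y (e + a, e + b)"
proof -
  have aux: "pmor x (c, c + t) = pmor y (e, e + t)" if "t \<le> N" for t
  proof (rule pre_unique)
    have "c + t \<le> c + N" "e + t \<le> e + N"
      using that by (auto simp: le_fun_def)
    then show "pre (pmor x (c, c + t)) (pmor x (c, c + N))" "pre (pmor y (e, e + t)) (pmor x (c, c + N))"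
      using path_prefix x y eq fun_le_add(1) by metis+
    have "fin (c + t) \<le> pdeg x" "fin (e + t) \<le> pdeg y"
      using x y \<open>c + t \<le> c + N\<close> \<open>e + t \<le> e + N\<close> fin_le_trans by blast+
    then show "deg \<Lambda> (pmor x (c, c + t)) = deg \<Lambda> (pmor y (e, e + t))"
      using path_morphism(2)[OF x(1) fun_le_add(1)] path_morphism(2)[OF y(1) fun_le_add(1)] by simp
  qed
  have le: "c + a \<le> c + b" "e + a \<le> e + b" "c + b \<le> c + N" "e + b \<le> e + N"
    using ab by (auto simp: le_fun_def)
  have fl: "fin (c + b) \<le> pdeg x" "fin (e + b) \<le> pdeg y" "fin (c + a) \<le> pdeg x" "fin (e + a) \<le> pdeg y"
    using le x y fin_le_trans by blast+
  have "pmor x (c + a, c + b) = pmor y (e + a, e + b)"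
  proof (rule factor_unique(2))
    show "cmp \<Lambda> (pmor x (c, c + a)) (pmor x (c + a, c + b)) = cmp \<Lambda> (pmor y (e, e + a)) (pmor y (e + a, e + b))"
      using path_cmp[OF x(1) fun_le_add(1) le(1) fl(1)] path_cmp[OF y(1) fun_le_add(1) le(2) fl(2)] aux[OF ab(2)]
      by simp
    show "deg \<Lambda> (pmor x (c, c + a)) = deg \<Lambda> (pmor y (e, e + a))"
      using path_morphism(2)[OF x(1) fun_le_add(1) fl(3)] path_morphism(2)[OF y(1) fun_le_add(1) fl(4)] by simp
  qed (use path_morphism[OF x(1) fun_le_add(1) fl(3)] path_morphism[OF y(1) fun_le_add(1) fl(4)]
      path_morphism[OF x(1) le(1) fl(1)] path_morphism[OF y(1) le(2) fl(2)] in auto)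
  then show ?thesis .
qed

lemma path_agree_init:
  assumes "x \<in> path_space k \<Lambda>" "fin N \<le> pdeg x" "y \<in> path_space k \<Lambda>" "fin N \<le> pdeg y"
    and "pmor x (0, N) = pmor y (0, N)" "a \<le> b" "b \<le> N"
  shows "pmor x (a, b) = pmor y (a, b)"
  using path_agree[of x 0 N y 0 a b] assms by simp

text \<open>Suited to concatenations, whose defining conditions control only the initial segments of
  degree d(\<mu>) + n.\<close>

lemma path_eq_cofinal:
  assumes "x \<in> path_space k \<Lambda>" "y \<in> path_space k \<Lambda>" "pdeg x = pdeg y"
    and "\<And>q. fin q \<le> pdeg x \<Longrightarrow> \<exists>t\<ge>q. fin t \<le> pdeg x \<and> pmor x (0, t) = pmor y (0, t)"
  shows "x = y"
proof (rule path_eqI[OF assms(1-3)])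
  fix p q assume "p \<le> q" "fin q \<le> pdeg x"
  then show "pmor x (p, q) = pmor y (p, q)"
    using assms path_agree_init by metis
qed

text \<open>The limit has the supremum of the degrees as its degree, possibly infinite in some
  coordinates. The last clause lets a statement about a finite part of the limit be checked on a
  single \<open>\<kappa> j\<close>.\<close>

lemma path_of_chain:
  assumes chain: "\<And>j. pre (\<kappa> j) (\<kappa> (Suc j))"
  shows "\<exists>x\<in>path_space k \<Lambda>.
    (\<forall>j. fin (deg \<Lambda> (\<kappa> j)) \<le> pdeg x \<and> pmor x (0, deg \<Lambda> (\<kappa> j)) = \<kappa> j) \<and>
    (\<forall>p. fin p \<le> pdeg x \<longrightarrow> (\<exists>j. p \<le> deg \<Lambda> (\<kappa> j)))"
proof -
  define D where "D i = (SUP j. enat (deg \<Lambda> (\<kappa> j) i))" for i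
  have mono: "pre (\<kappa> i) (\<kappa> j)" if "i \<le> j" for i j
    using that
  proof (induction rule: dec_induct)
    case base
    then show ?case
      using pre_refl chain preD by blast
  next
    case (step j)
    then show ?case
      using pre_trans chain by blast
  qed
  have D: "D \<in> NNinf k"
    using deg_NN preD(1)[OF chain] by (auto simp: NNinf_def NN_def D_def zero_enat_def)
  have le: "fin (deg \<Lambda> (\<kappa> j)) \<le> D" for j
    by (auto simp: le_fun_def fin_def D_def intro: SUP_upper)
  have bound: "\<exists>j. p \<le> deg \<Lambda> (\<kappa> j)" if "fin p \<le> D" for p
  proof -
    have "\<exists>j. p i \<le> deg \<Lambda> (\<kappa> j) i" for i
    proof (rule ccontr)
      assume *: "\<nexists>j. p i \<le> deg \<Lambda> (\<kappa> j) i"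
      then have "deg \<Lambda> (\<kappa> j) i \<le> p i - 1" "0 < p i" for j
        by (auto simp: not_le) (metis Suc_pred less_Suc_eq_le gr0I less_nat_zero_code)+
      then have "D i \<le> enat (p i - 1)" "0 < p i"
        by (auto simp: D_def intro: SUP_least)
      moreover have "enat (p i) \<le> D i"
        using that by (simp add: le_fun_def fin_def)
      ultimately have "enat (p i) \<le> enat (p i - 1)"
        by (metis order_trans)
      then show False
        using \<open>0 < p i\<close> by simp
    qed
    then obtain j where j: "\<And>i. p i \<le> deg \<Lambda> (\<kappa> (j i)) i"
      by metis
    \<comment> \<open>The sum dominates the finitely many indices \<open>j i\<close> with i < k, so
      one member of the chain serves all coordinates at once.\<close>
    have "p i \<le> deg \<Lambda> (\<kappa> (\<Sum>i<k. j i)) i" for i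
    proof (cases "i < k")
      case True
      then have "j i \<le> (\<Sum>i<k. j i)"
        by (intro member_le_sum) auto
      then have "deg \<Lambda> (\<kappa> (j i)) \<le> deg \<Lambda> (\<kappa> (\<Sum>i<k. j i))"
        using mono preD by blast
      then show ?thesis
        using order_trans[OF j] by (simp add: le_fun_def)
    next
      case False
      then show ?thesis
        using NNinf_fin_le[OF D that] by (simp add: NN_def)
    qed
    then show ?thesis
      by (auto simp: le_fun_def)
  qed
  define L where "L p = (SOME a. deg \<Lambda> a = p \<and> (\<exists>j. pre a (\<kappa> j)))" for p
  have L: "deg \<Lambda> (L p) = p" "\<exists>j. pre (L p) (\<kappa> j)" if "fin p \<le> D" for p
  proof -
    have "\<exists>a. deg \<Lambda> a = p \<and> (\<exists>j. pre a (\<kappa> j))"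
      using bound[OF that] pre_exists preD(1)[OF chain] by metis
    from someI_ex[OF this] show "deg \<Lambda> (L p) = p" "\<exists>j. pre (L p) (\<kappa> j)"
      by (auto simp: L_def)
  qed
  have common: "\<exists>j. pre (L p) (\<kappa> j) \<and> pre a (\<kappa> j)" if "fin p \<le> D" "pre a (\<kappa> i)" for p a i
    using L(2)[OF that(1)] that(2) mono pre_trans by (metis nat_le_linear)
  have Lpre: "pre (L p) (L q)" if le_pq: "p \<le> q" and q: "fin q \<le> D" for p q
  proof -
    have p: "fin p \<le> D"
      using fin_le_trans[OF le_pq q] .
    obtain i where "pre (L q) (\<kappa> i)"
      using L(2)[OF q] by blast
    then obtain j where "pre (L p) (\<kappa> j)" "pre (L q) (\<kappa> j)"
      using common[OF p] by blast
    then show ?thesis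
      by (rule pre_linear) (simp add: L(1)[OF p] L(1)[OF q] le_pq)
  qed
  obtain x where x: "x \<in> path_space k \<Lambda>" "pdeg x = D" "\<And>p. fin p \<le> D \<Longrightarrow> pmor x (0, p) = L p"
    using path_of_prefixes[OF D L(1) Lpre] by auto
  have "pmor x (0, deg \<Lambda> (\<kappa> j)) = \<kappa> j" for j
  proof -
    obtain i where "pre (L (deg \<Lambda> (\<kappa> j))) (\<kappa> i)" "pre (\<kappa> j) (\<kappa> i)"
      using common[OF le] mono[of j j] by blast
    then show ?thesis
      using pre_unique L(1)[OF le] x(3)[OF le] by metis
  qed
  then show ?thesis
    using x le bound by blast
qed

text \<open>This shows that the definite description behind \<open>concat_path\<close> denotes, and
  extends its last condition from segments that start at the junction to all segments of
  \<open>x\<close>.\<close>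

lemma concat_path:
  assumes mu: "\<mu> \<in> Mor \<Lambda>" and x: "x \<in> path_space k \<Lambda>" and v: "pvert \<Lambda> x 0 = src \<Lambda> \<mu>"
  shows "concat_path k \<Lambda> \<mu> x \<in> path_space k \<Lambda>"
    and "pdeg (concat_path k \<Lambda> \<mu> x) = fin (deg \<Lambda> \<mu>) + pdeg x"
    and "pmor (concat_path k \<Lambda> \<mu> x) (0, deg \<Lambda> \<mu>) = \<mu>"
    and "\<And>p q. p \<le> q \<Longrightarrow> fin q \<le> pdeg x \<Longrightarrow>
      pmor (concat_path k \<Lambda> \<mu> x) (deg \<Lambda> \<mu> + p, deg \<Lambda> \<mu> + q) = pmor x (p, q)"
proof -
  define d where "d = deg \<Lambda> \<mu>"
  define D where "D = fin d + pdeg x"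
  have D: "D \<in> NNinf k"
    using pdeg_NNinf[OF x] fin_NN_NNinf[OF deg_NN[OF mu]] by (simp add: D_def d_def NNinf_def)
  have le: "fin p \<le> D \<longleftrightarrow> fin (p - d) \<le> pdeg x" for p
    by (simp add: D_def fin_le_add_iff)
  define M where "M p = cmp \<Lambda> \<mu> (pmor x (0, p))" for p
  have x0: "pmor x (0, p) \<in> Mor \<Lambda>" "rng \<Lambda> (pmor x (0, p)) = src \<Lambda> \<mu>" "deg \<Lambda> (pmor x (0, p)) = p"
    if "fin p \<le> pdeg x" for p
    using path_morphism[OF x fun_zero_le that] v by (auto simp: fun_eq_iff)
  have M: "M p \<in> Mor \<Lambda>" "deg \<Lambda> (M p) = d + p" "pre \<mu> (M p)" if "fin p \<le> pdeg x" for p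
    using x0[OF that] mu by (auto simp: M_def cmp_Mor deg_cmp d_def pre_cmpI)
  have Mmono: "pre (M p) (M q)" if "p \<le> q" "fin q \<le> pdeg x" for p q
    unfolding M_def
    by (rule pre_cmp_mono) (use path_prefix[OF x fun_zero_le that] mu x0 that fin_le_trans in auto)
  \<comment> \<open>With truncated subtraction d + (p - d) is the join of d and p, so
    \<open>M (p - d)\<close> is the shortest of the paths \<open>M n\<close> that is long enough to
    have a prefix of degree p.\<close>
  define L where "L p = (SOME a. pre a (M (p - d)) \<and> deg \<Lambda> a = p)" for p
  have L: "pre (L p) (M (p - d))" "deg \<Lambda> (L p) = p" if "fin p \<le> D" for p
  proof -
    have f: "fin (p - d) \<le> pdeg x"
      using that le by simp
    have "p \<le> deg \<Lambda> (M (p - d))"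
      using M(2)[OF f] by (auto simp: le_fun_def)
    from someI_ex[OF pre_exists[OF M(1)[OF f] this]]
    show "pre (L p) (M (p - d))" "deg \<Lambda> (L p) = p"
      by (auto simp: L_def)
  qed
  have Lpre: "pre (L p) (L q)" if le_pq: "p \<le> q" and q: "fin q \<le> D" for p q
  proof -
    have f: "fin p \<le> D"
      using fin_le_trans[OF le_pq q] .
    have "p - d \<le> q - d"
      using le_pq by (simp add: le_fun_def diff_le_mono)
    then have "pre (L p) (M (q - d))"
      using L[OF f] Mmono q le pre_trans by blast
    then show ?thesis
      using L[OF q] L(2)[OF f] le_pq pre_linear by metis
  qed
  obtain y where y: "y \<in> path_space k \<Lambda>" "pdeg y = D" "\<And>p. fin p \<le> D \<Longrightarrow> pmor y (0, p) = L p"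
    using path_of_prefixes[OF D L(2) Lpre] by auto
  have yM: "pmor y (0, d + n) = M n" if "fin n \<le> pdeg x" for n
  proof -
    have "fin (d + n) \<le> D"
      using that le by simp
    then show ?thesis
      using y(3) L[of "d + n"] M(2)[OF that] pre_eq by simp
  qed
  have fd: "fin d \<le> D"
    using le[of d] by (simp add: zero_fun_def[symmetric] fun_diff_def)
  have y1: "pmor y (0, d) = \<mu>"
    using yM[of 0] M[of 0] path_pre(2)[OF y(1), of d \<mu>] fd y(2) by (simp add: d_def)
  have y2: "pmor y (d, d + n) = pmor x (0, n)" if "fin n \<le> pdeg x" for n
  proof -
    have f: "fin (d + n) \<le> pdeg y"
      using that le y(2) by simp
    show ?thesis
      using path_cmpD[OF y(1) fun_zero_le[of d], of "pmor x (0, n)"] x0[OF that] f yM[OF that] y1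
        path_morphism(4)[OF y(1) fun_zero_le[of d]] fd y(2)
      by (simp add: M_def)
  qed
  let ?Q = "\<lambda>y. y \<in> path_space k \<Lambda> \<and> pdeg y = fin (deg \<Lambda> \<mu>) + pdeg x \<and>
     pmor y (0, deg \<Lambda> \<mu>) = \<mu> \<and>
     (\<forall>n\<in>NN k. fin n \<le> pdeg x \<longrightarrow> pmor y (deg \<Lambda> \<mu>, deg \<Lambda> \<mu> + n) = pmor x (0, n))"
  have "?Q y"
    using y y1 y2 by (simp add: d_def D_def)
  moreover have "z = y" if "?Q z" for z
  proof (rule path_eq_cofinal)
    show "z \<in> path_space k \<Lambda>" "y \<in> path_space k \<Lambda>" "pdeg z = pdeg y"
      using that y by (auto simp: d_def D_def)
    show "\<exists>t\<ge>q. fin t \<le> pdeg z \<and> pmor z (0, t) = pmor y (0, t)" if q: "fin q \<le> pdeg z" for q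
    proof (intro exI conjI)
      have zD: "pdeg z = D"
        using \<open>?Q z\<close> by (simp add: D_def d_def)
      let ?n = "q - d"
      have n: "fin ?n \<le> pdeg x"
        using q zD le by simp
      then show f: "fin (d + ?n) \<le> pdeg z"
        using zD le by simp
      show "q \<le> d + ?n"
        by (auto simp: le_fun_def)
      have "?n \<in> NN k"
        using n x fin_le_pdeg_NN by blast
      then have "pmor z (d, d + ?n) = pmor y (d, d + ?n)" "pmor z (0, d) = pmor y (0, d)"
        using \<open>?Q z\<close> n y1 y2 by (simp_all add: d_def)
      then show "pmor z (0, d + ?n) = pmor y (0, d + ?n)"
        using path_cmp[OF _ fun_zero_le fun_le_add(1), of z k \<Lambda> d ?n] \<open>?Q z\<close>
          path_cmp[OF y(1) fun_zero_le fun_le_add(1), of d ?n] f zD y(2) by simp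
    qed
  qed
  ultimately have "concat_path k \<Lambda> \<mu> x = y"
    unfolding concat_path_def by (rule the_equality)
  then show "concat_path k \<Lambda> \<mu> x \<in> path_space k \<Lambda>"
    "pdeg (concat_path k \<Lambda> \<mu> x) = fin (deg \<Lambda> \<mu>) + pdeg x"
    "pmor (concat_path k \<Lambda> \<mu> x) (0, deg \<Lambda> \<mu>) = \<mu>"
    using y y1 by (simp_all add: D_def d_def)
  show "pmor (concat_path k \<Lambda> \<mu> x) (deg \<Lambda> \<mu> + p, deg \<Lambda> \<mu> + q) = pmor x (p, q)"
    if "p \<le> q" "fin q \<le> pdeg x" for p q
    using path_agree[OF y(1), of d q x 0 p q] x y2[OF that(2)] that le y(2) \<open>concat_path k \<Lambda> \<mu> x = y\<close>
    by (simp add: d_def)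
qed

end

section \<open>Boundary paths\<close>

lemma boundary_pathsD:
  assumes "x \<in> boundary_paths k C"
  shows "x \<in> path_space k C"
    and "\<And>n E. fin n \<le> pdeg x \<Longrightarrow> E \<in> FE C (pvert C x n) \<Longrightarrow>
      \<exists>m. n \<le> m \<and> fin m \<le> pdeg x \<and> pmor x (n, m) \<in> E"
proof -
  show x: "x \<in> path_space k C"
    using assms by (simp add: boundary_paths_def)
  show "\<exists>m. n \<le> m \<and> fin m \<le> pdeg x \<and> pmor x (n, m) \<in> E"
    if "fin n \<le> pdeg x" "E \<in> FE C (pvert C x n)" for n E
    using assms fin_le_pdeg_NN[OF x] that unfolding boundary_paths_def by blast
qed

lemma boundary_pathsI:
  assumes "x \<in> path_space k C"
    and "\<And>n E. fin n \<le> pdeg x \<Longrightarrow> E \<in> FE C (pvert C x n) \<Longrightarrow>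
      \<exists>m. n \<le> m \<and> fin m \<le> pdeg x \<and> pmor x (n, m) \<in> E"
  shows "x \<in> boundary_paths k C"
  using assms fin_le_pdeg_NN[OF assms(1)] unfolding boundary_paths_def by blast

lemma shift_boundary:
  assumes "x \<in> boundary_paths k C" "fin n \<le> pdeg x"
  shows "shift k n x \<in> boundary_paths k C"
proof (rule boundary_pathsI)
  note x = boundary_pathsD[OF assms(1)]
  note s = shift_path[OF x(1) assms(2)]
  show "shift k n x \<in> path_space k C"
    by (rule s)
  fix m E assume m: "fin m \<le> pdeg (shift k n x)" and E: "E \<in> FE C (pvert C (shift k n x) m)"
  have m': "fin (m + n) \<le> pdeg x"
    using m s(2,3) by simp
  then obtain t where t: "m + n \<le> t" "fin t \<le> pdeg x" "pmor x (m + n, t) \<in> E"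
    using x(2) E s(5) by metis
  have eq: "t - n + n = t" and le: "m \<le> t - n"
    using t(1) by (auto simp: le_fun_def fun_eq_iff) (metis add_leD2 le_add_diff_inverse2, metis add_le_imp_le_diff)
  show "\<exists>t. m \<le> t \<and> fin t \<le> pdeg (shift k n x) \<and> pmor (shift k n x) (m, t) \<in> E"
    using le t s(2,3) s(4)[OF le] eq by (intro exI[of _ "t - n"]) simp
qed

text \<open>A path that eventually decides each of the countably many pairs of a path \<open>\<lambda>\<close> and a finite
  exhaustive set at \<open>s(\<lambda>)\<close>, as in the Rasiowa--Sikorski lemma, is a boundary path.\<close>

lemma (in k_graph) boundary_path_exists:
  assumes v: "v \<in> Obj \<Lambda>"
  obtains x where "x \<in> boundary_paths k \<Lambda>" "pvert \<Lambda> x 0 = v"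
proof -
  define S where "S = {(l, E). l \<in> Mor \<Lambda> \<and> E \<in> FE \<Lambda> (src \<Lambda> l)}"
  have "S \<subseteq> Mor \<Lambda> \<times> {E. finite E \<and> E \<subseteq> Mor \<Lambda>}"
    by (auto simp: S_def FE_def exhaustive_def paths_from_def)
  moreover have "countable (Mor \<Lambda> \<times> {E. finite E \<and> E \<subseteq> Mor \<Lambda>})"
    using countable_Mor countable_Collect_finite_subset by (intro countable_SIGMA) blast+
  ultimately have cS: "countable S"
    using countable_subset by blast
  \<comment> \<open>If some path has both \<open>l\<close> and \<open>\<tau>\<close> as initial
    segments, the first alternative is excluded; being decided then means that the path meets
    \<open>E\<close> after \<open>l\<close>.\<close>
  define decides where "decides = (\<lambda>(l, E) \<tau>. (\<nexists>t. pre l t \<and> pre \<tau> t) \<or> (\<exists>\<nu>\<in>E. pre (cmp \<Lambda> l \<nu>) \<tau>))"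
  have dense: "\<exists>\<tau>'. pre \<tau> \<tau>' \<and> decides s \<tau>'" if s: "s \<in> S" and \<tau>: "\<tau> \<in> Mor \<Lambda>" for s \<tau>
  proof -
    obtain l E where lE: "s = (l, E)" "l \<in> Mor \<Lambda>" "E \<in> FE \<Lambda> (src \<Lambda> l)"
      using s by (auto simp: S_def)
    show ?thesis
    proof (cases "\<exists>t. pre l t \<and> pre \<tau> t")
      case False
      then show ?thesis
        using lE pre_refl[OF \<tau>] by (auto simp: decides_def)
    next
      case True
      then obtain b where b: "b \<in> Mor \<Lambda>" "src \<Lambda> l = rng \<Lambda> b" "pre \<tau> (cmp \<Lambda> l b)"
        by (auto simp: is_prefix_def)
      then have "b \<in> paths_from \<Lambda> (src \<Lambda> l)"
        by (simp add: paths_from_def)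
      \<comment> \<open>Exhaustiveness prolongs \<open>b\<close> to a path \<open>c\<close> through
        a member of \<open>E\<close>; composing \<open>l\<close> with \<open>c\<close> then extends
        \<open>\<tau>\<close> and decides the pair.\<close>
      then obtain \<nu> where n: "\<nu> \<in> E" "\<nu> \<in> Mor \<Lambda>" "rng \<Lambda> \<nu> = src \<Lambda> l" "MCE \<Lambda> \<nu> b \<noteq> {}"
        using lE(3) unfolding FE_def exhaustive_def paths_from_def by blast
      then obtain c where c: "pre \<nu> c" "pre b c"
        using MCE_iff b(1) by blast
      then have "pre (cmp \<Lambda> l \<nu>) (cmp \<Lambda> l c)" "pre (cmp \<Lambda> l b) (cmp \<Lambda> l c)"
        using pre_cmp_mono lE(2) n b(2) by simp_all
      then show ?thesis
        using pre_trans[OF b(3)] n(1) lE(1) by (auto simp: decides_def)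
    qed
  qed
  let ?P = "\<lambda>_::nat. \<lambda>\<tau>. \<tau> \<in> Mor \<Lambda> \<and> rng \<Lambda> \<tau> = v"
  \<comment> \<open>\<open>to_nat_on\<close> enumerates the countable set \<open>S\<close>; stage j
    of the construction treats the pair with number j, if there is one.\<close>
  let ?Q = "\<lambda>j \<tau> \<tau>'. pre \<tau> \<tau>' \<and> (\<forall>s\<in>S. to_nat_on S s = j \<longrightarrow> decides s \<tau>')"
  have "\<exists>f. \<forall>n. ?P n (f n) \<and> ?Q n (f n) (f (Suc n))"
  proof (rule dependent_nat_choice[of ?P ?Q])
    show "\<exists>\<tau>. \<tau> \<in> Mor \<Lambda> \<and> rng \<Lambda> \<tau> = v"
      using idm_Mor[OF v] rng_idm[OF v] by blast
    fix \<tau> j assume \<tau>: "\<tau> \<in> Mor \<Lambda> \<and> rng \<Lambda> \<tau> = v"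
    show "\<exists>\<tau>'. (\<tau>' \<in> Mor \<Lambda> \<and> rng \<Lambda> \<tau>' = v) \<and> ?Q j \<tau> \<tau>'"
    proof (cases "\<exists>s\<in>S. to_nat_on S s = j")
      case True
      then obtain s where s: "s \<in> S" "to_nat_on S s = j"
        by blast
      obtain \<tau>' where t: "pre \<tau> \<tau>'" "decides s \<tau>'"
        using dense[OF s(1)] \<tau> by blast
      have "\<forall>s'\<in>S. to_nat_on S s' = j \<longrightarrow> s' = s"
        using to_nat_on_inj[OF cS] s by blast
      then show ?thesis
        using t(2) preD[OF t(1)] t(1) \<tau> by (intro exI[of _ \<tau>']) auto
    next
      case False
      then show ?thesis
        using pre_refl \<tau> by blast
    qed
  qed
  then obtain \<kappa> where \<kappa>: "\<And>j. \<kappa> j \<in> Mor \<Lambda>" "\<And>j. rng \<Lambda> (\<kappa> j) = v" "\<And>j. pre (\<kappa> j) (\<kappa> (Suc j))"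
    "\<And>j s. s \<in> S \<Longrightarrow> to_nat_on S s = j \<Longrightarrow> decides s (\<kappa> (Suc j))"
    by blast
  obtain x where x: "x \<in> path_space k \<Lambda>" "\<And>j. fin (deg \<Lambda> (\<kappa> j)) \<le> pdeg x"
    "\<And>j. pmor x (0, deg \<Lambda> (\<kappa> j)) = \<kappa> j" "\<And>p. fin p \<le> pdeg x \<Longrightarrow> \<exists>j. p \<le> deg \<Lambda> (\<kappa> j)"
    using path_of_chain[of \<kappa>, OF \<kappa>(3)] by blast
  have "x \<in> boundary_paths k \<Lambda>"
  proof (rule boundary_pathsI[OF x(1)])
    fix n E assume n: "fin n \<le> pdeg x" and E: "E \<in> FE \<Lambda> (pvert \<Lambda> x n)"
    let ?l = "pmor x (0, n)"
    note l = path_morphism[OF x(1) fun_zero_le n]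
    have s: "(?l, E) \<in> S"
      using l E by (simp add: S_def)
    define j where "j = to_nat_on S (?l, E)"
    obtain i where i: "n \<le> deg \<Lambda> (\<kappa> i)"
      using x(4)[OF n] by blast
    \<comment> \<open>The initial segment of degree \<open>?N\<close> extends both \<open>?l\<close>
      and \<open>\<kappa> (Suc j)\<close>, which rules out the first alternative in
      \<open>decides\<close>.\<close>
    let ?N = "sup (deg \<Lambda> (\<kappa> i)) (deg \<Lambda> (\<kappa> (Suc j)))"
    have N: "fin ?N \<le> pdeg x"
      using fin_sup_le x(2) by blast
    have "n \<le> ?N" "deg \<Lambda> (\<kappa> (Suc j)) \<le> ?N"
      using i by (auto intro: order_trans)
    then have "pre ?l (pmor x (0, ?N))" "pre (\<kappa> (Suc j)) (pmor x (0, ?N))"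
      using path_prefix[OF x(1) fun_zero_le _ N] x(3)[of "Suc j"] by metis+
    moreover have "decides (?l, E) (\<kappa> (Suc j))"
      using \<kappa>(4)[OF s] j_def by blast
    ultimately obtain \<nu> where \<nu>: "\<nu> \<in> E" "pre (cmp \<Lambda> ?l \<nu>) (\<kappa> (Suc j))"
      by (auto simp: decides_def)
    have nM: "\<nu> \<in> Mor \<Lambda>" "rng \<Lambda> \<nu> = pvert \<Lambda> x n"
      using E \<nu>(1) by (auto simp: FE_def exhaustive_def paths_from_def)
    have dl: "deg \<Lambda> (cmp \<Lambda> ?l \<nu>) = n + deg \<Lambda> \<nu>"
      using deg_cmp[OF l(1) nM(1)] l nM(2) by (simp add: fun_eq_iff)
    have p: "n + deg \<Lambda> \<nu> \<le> deg \<Lambda> (\<kappa> (Suc j))" "cmp \<Lambda> ?l \<nu> = pmor x (0, n + deg \<Lambda> \<nu>)"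
      using path_pre[OF x(1,2)] x(3) \<nu>(2) dl by metis+
    then have f: "fin (n + deg \<Lambda> \<nu>) \<le> pdeg x"
      using fin_le_trans x(2) by blast
    have "pmor x (n, n + deg \<Lambda> \<nu>) = \<nu>"
      by (rule path_cmpD[OF x(1) fun_zero_le f nM]) (use p in simp)
    then show "\<exists>m. n \<le> m \<and> fin m \<le> pdeg x \<and> pmor x (n, m) \<in> E"
      using f \<nu>(1) by (metis fun_le_add(1))
  qed
  moreover have "pvert \<Lambda> x 0 = v"
    using path_morphism(3)[OF x(1) fun_zero_le x(2)] x(3) \<kappa>(2) by metis
  ultimately show thesis
    using that by blast
qed

section \<open>Prolonging boundary paths to the left under row-finiteness\<close>

locale row_finite_k_graph = k_graph k \<Lambda> for k :: nat and \<Lambda> :: "('o, 'm) kgraph" +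
  assumes row_finite: "row_finite k \<Lambda>"
begin

text \<open>Finite exhaustive sets are transported along \<open>\<mu>\<close> by collecting the
  tails of minimal common extensions. These tails have finitely many degrees, so row-finiteness
  bounds their number. For exhaustiveness, a common extension of some \<nu> in \<open>E\<close> with
  \<mu>\<beta> contains a minimal common extension of \<nu> with \<mu>, and cancelling \<mu> leaves
  a tail that has a common extension with \<beta>.\<close>

lemma FE_extensions:
  assumes mu: "\<mu> \<in> Mor \<Lambda>" and E: "E \<in> FE \<Lambda> (rng \<Lambda> \<mu>)"
  shows "{\<alpha> \<in> paths_from \<Lambda> (src \<Lambda> \<mu>). \<exists>\<nu>\<in>E. cmp \<Lambda> \<mu> \<alpha> \<in> MCE \<Lambda> \<nu> \<mu>} \<in> FE \<Lambda> (src \<Lambda> \<mu>)" (is "?X \<in> _")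
proof -
  have EM: "\<nu> \<in> Mor \<Lambda>" "rng \<Lambda> \<nu> = rng \<Lambda> \<mu>" if "\<nu> \<in> E" for \<nu>
    using E that by (auto simp: FE_def exhaustive_def paths_from_def)
  have "?X \<subseteq> (\<Union>\<nu>\<in>E. {\<alpha> \<in> paths_from \<Lambda> (src \<Lambda> \<mu>). deg \<Lambda> \<alpha> = sup (deg \<Lambda> \<nu>) (deg \<Lambda> \<mu>) - deg \<Lambda> \<mu>})"
  proof
    fix \<alpha> assume "\<alpha> \<in> ?X"
    then obtain \<nu> where a: "\<alpha> \<in> paths_from \<Lambda> (src \<Lambda> \<mu>)" "\<nu> \<in> E" "cmp \<Lambda> \<mu> \<alpha> \<in> MCE \<Lambda> \<nu> \<mu>"
      by blast
    then have "deg \<Lambda> \<mu> + deg \<Lambda> \<alpha> = sup (deg \<Lambda> \<nu>) (deg \<Lambda> \<mu>)"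
      using MCE_iff EM mu deg_cmp[OF mu, of \<alpha>] by (simp add: paths_from_def)
    then have "deg \<Lambda> \<alpha> = sup (deg \<Lambda> \<nu>) (deg \<Lambda> \<mu>) - deg \<Lambda> \<mu>"
      by (metis fun_add_diff_cancel)
    then show "\<alpha> \<in> (\<Union>\<nu>\<in>E. {\<alpha> \<in> paths_from \<Lambda> (src \<Lambda> \<mu>). deg \<Lambda> \<alpha> = sup (deg \<Lambda> \<nu>) (deg \<Lambda> \<mu>) - deg \<Lambda> \<mu>})"
      using a by blast
  qed
  moreover have "finite (\<Union>\<nu>\<in>E. {\<alpha> \<in> paths_from \<Lambda> (src \<Lambda> \<mu>). deg \<Lambda> \<alpha> = sup (deg \<Lambda> \<nu>) (deg \<Lambda> \<mu>) - deg \<Lambda> \<mu>})"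
  proof (rule finite_UN_I)
    show "finite E"
      using E by (simp add: FE_def)
    show "finite {\<alpha> \<in> paths_from \<Lambda> (src \<Lambda> \<mu>). deg \<Lambda> \<alpha> = sup (deg \<Lambda> \<nu>) (deg \<Lambda> \<mu>) - deg \<Lambda> \<mu>}"
      if "\<nu> \<in> E" for \<nu>
    proof -
      have "sup (deg \<Lambda> \<nu>) (deg \<Lambda> \<mu>) - deg \<Lambda> \<mu> \<in> NN k"
        using deg_NN[OF mu] deg_NN[OF EM(1)[OF that]] NN_sup NN_diff by blast
      then show ?thesis
        using row_finite src_Obj[OF mu] by (auto simp: row_finite_def)
    qed
  qed
  ultimately have "finite ?X"
    by (rule finite_subset)
  moreover have "exhaustive \<Lambda> (src \<Lambda> \<mu>) ?X"
    unfolding exhaustive_def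
  proof (intro conjI ballI)
    show "?X \<subseteq> paths_from \<Lambda> (src \<Lambda> \<mu>)"
      by blast
    fix \<beta> assume "\<beta> \<in> paths_from \<Lambda> (src \<Lambda> \<mu>)"
    then have b: "\<beta> \<in> Mor \<Lambda>" "rng \<Lambda> \<beta> = src \<Lambda> \<mu>"
      by (auto simp: paths_from_def)
    have mb: "cmp \<Lambda> \<mu> \<beta> \<in> Mor \<Lambda>" "rng \<Lambda> (cmp \<Lambda> \<mu> \<beta>) = rng \<Lambda> \<mu>"
      using b mu cmp_Mor rng_cmp by auto
    then obtain \<nu> where n: "\<nu> \<in> E" "MCE \<Lambda> \<nu> (cmp \<Lambda> \<mu> \<beta>) \<noteq> {}"
      using E unfolding FE_def exhaustive_def paths_from_def by blast
    then obtain c where c: "pre \<nu> c" "pre (cmp \<Lambda> \<mu> \<beta>) c"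
      using MCE_iff EM mb by blast
    have mc: "pre \<mu> c"
      using pre_trans[OF pre_cmpI c(2)] mu b by simp
    obtain e where e: "e \<in> MCE \<Lambda> \<nu> \<mu>" "pre e c"
      using MCE_below[OF c(1) mc] by blast
    have "pre \<mu> e"
      using e(1) MCE_iff EM n mu by blast
    then obtain \<alpha> where a: "\<alpha> \<in> Mor \<Lambda>" "src \<Lambda> \<mu> = rng \<Lambda> \<alpha>" "e = cmp \<Lambda> \<mu> \<alpha>"
      by (auto simp: is_prefix_def)
    obtain \<gamma> where g: "\<gamma> \<in> Mor \<Lambda>" "src \<Lambda> \<mu> = rng \<Lambda> \<gamma>" "c = cmp \<Lambda> \<mu> \<gamma>"
      using mc by (auto simp: is_prefix_def)
    have "pre \<alpha> \<gamma>" "pre \<beta> \<gamma>"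
      using pre_cmp_cancel e(2) c(2) a g b mu by metis+
    then have "MCE \<Lambda> \<alpha> \<beta> \<noteq> {}"
      using MCE_below by blast
    moreover have "\<alpha> \<in> ?X"
      using a e n by (auto simp: paths_from_def)
    ultimately show "\<exists>\<nu>\<in>?X. MCE \<Lambda> \<nu> \<beta> \<noteq> {}"
      by blast
  qed
  ultimately show ?thesis
    by (simp add: FE_def)
qed

text \<open>The degree n may lie before the end of \<mu>, or even be incomparable with d(\<mu>). The
  exhaustive set is therefore moved by \<open>FE_extensions\<close> to the vertex at the join of n
  and d(\<mu>), which lies on \<open>x\<close>, where the boundary condition of \<open>x\<close>
  applies.\<close>

lemma concat_boundary:
  assumes mu: "\<mu> \<in> Mor \<Lambda>" and x: "x \<in> boundary_paths k \<Lambda>" and v: "pvert \<Lambda> x 0 = src \<Lambda> \<mu>"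
  shows "concat_path k \<Lambda> \<mu> x \<in> boundary_paths k \<Lambda>"
proof (rule boundary_pathsI)
  let ?y = "concat_path k \<Lambda> \<mu> x" and ?d = "deg \<Lambda> \<mu>"
  note y = concat_path[OF mu boundary_pathsD(1)[OF x] v]
  show "?y \<in> path_space k \<Lambda>"
    by (rule y)
  have fle: "fin p \<le> pdeg ?y \<longleftrightarrow> fin (p - ?d) \<le> pdeg x" for p
    by (simp add: y(2) fin_le_add_iff)
  fix n E assume n: "fin n \<le> pdeg ?y" and E: "E \<in> FE \<Lambda> (pvert \<Lambda> ?y n)"
  \<comment> \<open>The join of n and d(\<mu>), measured along \<open>x\<close> from the
    junction.\<close>
  define m where "m = sup n ?d - ?d"
  have m: "?d + m = sup n ?d"
    by (simp add: m_def fun_add_diff_le)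
  have nm: "n \<le> ?d + m"
    using m by simp
  have fd: "fin ?d \<le> pdeg ?y"
    using fle[of ?d] by (simp add: zero_fun_def[symmetric] fun_diff_def)
  have fm: "fin (?d + m) \<le> pdeg ?y"
    using m fin_sup_le[OF n fd] by simp
  then have fmx: "fin m \<le> pdeg x"
    using fle by simp
  note \<theta> = path_morphism[OF y(1) nm fm]
  have v': "pvert \<Lambda> ?y (?d + m) = pvert \<Lambda> x m"
    using y(4)[OF order_refl fmx] by (simp add: pvert_def)
  obtain t where t: "m \<le> t" "fin t \<le> pdeg x"
    "pmor x (m, t) \<in> {\<alpha> \<in> paths_from \<Lambda> (src \<Lambda> (pmor ?y (n, ?d + m))).
      \<exists>\<nu>\<in>E. cmp \<Lambda> (pmor ?y (n, ?d + m)) \<alpha> \<in> MCE \<Lambda> \<nu> (pmor ?y (n, ?d + m))}"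
    using boundary_pathsD(2)[OF x fmx, OF FE_extensions[OF \<theta>(1), of E, unfolded \<theta>(3,4) v', OF E]]
    unfolding \<theta>(4) v' by blast
  then obtain \<nu> where \<nu>: "\<nu> \<in> E" "cmp \<Lambda> (pmor ?y (n, ?d + m)) (pmor x (m, t)) \<in> MCE \<Lambda> \<nu> (pmor ?y (n, ?d + m))"
    by blast
  have le: "?d + m \<le> ?d + t"
    using t(1) by (simp add: le_fun_def)
  have ft: "fin (?d + t) \<le> pdeg ?y"
    using t(2) fle by simp
  have "cmp \<Lambda> (pmor ?y (n, ?d + m)) (pmor x (m, t)) = pmor ?y (n, ?d + t)"
    using path_cmp[OF y(1) nm le ft] y(4)[OF t(1,2)] by simp
  moreover have "\<nu> \<in> Mor \<Lambda>"
    using E \<nu>(1) by (auto simp: FE_def exhaustive_def paths_from_def)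
  ultimately have "pre \<nu> (pmor ?y (n, ?d + t))"
    using \<nu>(2) MCE_iff[OF _ \<theta>(1)] by simp
  then have "n + deg \<Lambda> \<nu> \<le> ?d + t" "pmor ?y (n, n + deg \<Lambda> \<nu>) = \<nu>"
    using path_pre_from[OF y(1) order_trans[OF nm le] ft] by auto
  then show "\<exists>m. n \<le> m \<and> fin m \<le> pdeg ?y \<and> pmor ?y (n, m) \<in> E"
    using \<nu>(1) fin_le_trans[OF _ ft] by (metis fun_le_add(1))
qed

section \<open>The desourcification\<close>

abbreviation "bdry \<equiv> boundary_paths k \<Lambda>"
abbreviation "mcl \<equiv> mor_class k \<Lambda>"
abbreviation "ocl \<equiv> obj_class k \<Lambda>"
abbreviation "des \<equiv> desource k \<Lambda>"

text \<open>The three quantities compared by \<open>mor_rel\<close>, bundled so that equality of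
  classes becomes an equation of terms: the part of the step that lies on \<open>x\<close>, the
  excess of \<open>m\<close>, and the nominal length.\<close>

definition mor_key where
  "mor_key x m n = (pmor x (meetd m (pdeg x), meetd n (pdeg x)), m - meetd m (pdeg x), n - m)"

definition obj_key where
  "obj_key x m = (pvert \<Lambda> x (meetd m (pdeg x)), m - meetd m (pdeg x))"

definition valid where
  "valid x m n \<longleftrightarrow> x \<in> bdry \<and> m \<le> n \<and> n \<in> NN k"

lemma valid_NN: "valid x m n \<Longrightarrow> m \<in> NN k" "valid x m n \<Longrightarrow> n \<in> NN k"
  using NN_mono by (auto simp: valid_def)

lemma validD: "valid x m n \<Longrightarrow> x \<in> bdry" "valid x m n \<Longrightarrow> x \<in> path_space k \<Lambda>" "valid x m n \<Longrightarrow> m \<le> n"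
  by (auto simp: valid_def dest: boundary_pathsD(1))

lemma valid_trans: "valid x m n \<Longrightarrow> valid x n t \<Longrightarrow> valid x m t"
  by (auto simp: valid_def intro: order_trans)

lemma mem_mcl: "(y, p, q) \<in> mcl x m n \<longleftrightarrow> valid y p q \<and> mor_key y p q = mor_key x m n"
  if "valid x m n"
  using that NN_mono by (auto simp: mor_class_def mor_rel_def mor_pairs_def valid_def mor_key_def)

lemma mem_ocl: "(y, p) \<in> ocl x m \<longleftrightarrow> y \<in> bdry \<and> p \<in> NN k \<and> obj_key y p = obj_key x m"
  if "x \<in> bdry" "m \<in> NN k"
  using that by (auto simp: obj_class_def obj_rel_def obj_pairs_def obj_key_def)

lemma mcl_eq_iff:
  assumes "valid x m n" "valid y p q"
  shows "mcl x m n = mcl y p q \<longleftrightarrow> mor_key x m n = mor_key y p q"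
proof
  assume "mcl x m n = mcl y p q"
  then have "(x, m, n) \<in> mcl y p q"
    using mem_mcl[OF assms(1)] assms(1) by blast
  then show "mor_key x m n = mor_key y p q"
    using mem_mcl[OF assms(2)] by blast
next
  assume "mor_key x m n = mor_key y p q"
  then have "c \<in> mcl x m n \<longleftrightarrow> c \<in> mcl y p q" for c
    using mem_mcl[OF assms(1)] mem_mcl[OF assms(2)] by (metis prod_cases3)
  then show "mcl x m n = mcl y p q"
    by blast
qed

lemma ocl_eq_iff:
  assumes "x \<in> bdry" "m \<in> NN k" "y \<in> bdry" "p \<in> NN k"
  shows "ocl x m = ocl y p \<longleftrightarrow> obj_key x m = obj_key y p"
proof
  assume "ocl x m = ocl y p"
  then have "(x, m) \<in> ocl y p"
    using mem_ocl assms by blast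
  then show "obj_key x m = obj_key y p"
    using mem_ocl assms by blast
next
  assume "obj_key x m = obj_key y p"
  then have "c \<in> ocl x m \<longleftrightarrow> c \<in> ocl y p" for c
    using mem_ocl assms by (cases c) metis
  then show "ocl x m = ocl y p"
    by blast
qed

lemma Mor_des: "A \<in> Mor des \<longleftrightarrow> (\<exists>x m n. valid x m n \<and> A = mcl x m n)"
proof
  assume "A \<in> Mor des"
  then show "\<exists>x m n. valid x m n \<and> A = mcl x m n"
    by (force simp: desource_def quotient_def mor_pairs_def valid_def mor_class_def)
next
  assume "\<exists>x m n. valid x m n \<and> A = mcl x m n"
  then obtain x m n where "valid x m n" "A = mcl x m n"
    by blast
  then show "A \<in> Mor des"
    using valid_NN[of x m n] by (auto simp: desource_def quotient_def mor_pairs_def valid_def mor_class_def)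
qed

lemma mcl_Mor: "valid x m n \<Longrightarrow> mcl x m n \<in> Mor des"
  using Mor_des by blast

lemma ocl_Obj: "x \<in> bdry \<Longrightarrow> m \<in> NN k \<Longrightarrow> ocl x m \<in> Obj des"
  by (auto simp: desource_def quotient_def obj_pairs_def obj_class_def)

lemma pmor_meetd:
  assumes "valid x m n"
  shows "pmor x (meetd m (pdeg x), meetd n (pdeg x)) \<in> Mor \<Lambda>"
    and "deg \<Lambda> (pmor x (meetd m (pdeg x), meetd n (pdeg x))) = meetd n (pdeg x) - meetd m (pdeg x)"
    and "rng \<Lambda> (pmor x (meetd m (pdeg x), meetd n (pdeg x))) = pvert \<Lambda> x (meetd m (pdeg x))"
    and "src \<Lambda> (pmor x (meetd m (pdeg x), meetd n (pdeg x))) = pvert \<Lambda> x (meetd n (pdeg x))"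
  using path_morphism(1-4)[OF validD(2)[OF assms] meetd_mono[OF validD(3)[OF assms]] fin_meetd_le] .

lemma mor_key_deg:
  assumes "valid x m n" "valid y p q" "mor_key x m n = mor_key y p q"
  shows "meetd n (pdeg x) - meetd m (pdeg x) = meetd q (pdeg y) - meetd p (pdeg y)"
  using assms(3) pmor_meetd(2)[OF assms(1)] pmor_meetd(2)[OF assms(2)] by (simp add: mor_key_def)

text \<open>Makes range and source independent of representatives. The excess at \<open>n\<close> is
  not a component of the key; it is recovered from \<open>meetd_add_diff\<close> with a = n -
  m.\<close>

lemma mor_key_ends:
  assumes "valid x m n" "valid y p q" and key: "mor_key x m n = mor_key y p q"
  shows "obj_key x m = obj_key y p" "obj_key x n = obj_key y q"
proof -
  show "obj_key x m = obj_key y p"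
    using key pmor_meetd(3)[OF assms(1)] pmor_meetd(3)[OF assms(2)] by (simp add: mor_key_def obj_key_def)
  have "m + (n - m) - meetd (m + (n - m)) (pdeg x) = p + (n - m) - meetd (p + (n - m)) (pdeg y)"
    by (rule meetd_add_diff(2)[OF validD(3)[OF assms(1)] validD(3)[OF assms(2)]])
      (use key mor_key_deg[OF assms] in \<open>auto simp: mor_key_def\<close>)
  moreover have "m + (n - m) = n" "p + (n - m) = q"
    using key fun_add_diff_le[OF validD(3)[OF assms(1)]] fun_add_diff_le[OF validD(3)[OF assms(2)]]
    by (simp_all add: mor_key_def)
  ultimately have "n - meetd n (pdeg x) = q - meetd q (pdeg y)"
    by simp
  then show "obj_key x n = obj_key y q"
    using key pmor_meetd(4)[OF assms(1)] pmor_meetd(4)[OF assms(2)] by (simp add: mor_key_def obj_key_def)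
qed

text \<open>Uniqueness of factorisation in the desourcification, expressed by keys. By
  \<open>meetd_add_diff\<close> the intermediate degrees are truncated alike relative to both
  starting points, and \<open>path_agree\<close> compares the segments of \<Lambda> that are
  left.\<close>

lemma mor_key_factor:
  assumes x: "valid x m n" and y: "valid y p q" and key: "mor_key x m n = mor_key y p q"
    and ab: "a \<le> b" "b \<le> n - m"
  shows "mor_key x (m + a) (m + b) = mor_key y (p + a) (p + b)"
proof -
  let ?c = "meetd m (pdeg x)" and ?e = "meetd p (pdeg y)"
  note h = validD(3)[OF x] validD(3)[OF y] 
  have k: "m - ?c = p - ?e" "n - m = q - p"
    "pmor x (?c, meetd n (pdeg x)) = pmor y (?e, meetd q (pdeg y))"
    using key by (auto simp: mor_key_def)
  note arith = meetd_add_diff[OF h k(1,2) mor_key_deg[OF x y key]]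
  have a: "a \<le> n - m"
    using ab by (rule order_trans)
  \<comment> \<open>\<open>N\<close>, \<open>a'\<close> and \<open>b'\<close> are positions on the
    truncated segment, measured from its own start; they are the same for both
    representatives.\<close>
  define N where "N = meetd n (pdeg x) - ?c"
  define a' where "a' = meetd (m + a) (pdeg x) - ?c"
  define b' where "b' = meetd (m + b) (pdeg x) - ?c"
  have le: "m \<le> m + a" "m + a \<le> m + b" "p \<le> p + a" "p + a \<le> p + b"
    using ab by (auto simp: le_fun_def)
  have N: "?c + N = meetd n (pdeg x)" "?e + N = meetd q (pdeg y)"
    using fun_add_diff_le[OF meetd_mono[OF h(1), of "pdeg x"]] fun_add_diff_le[OF meetd_mono[OF h(2), of "pdeg y"]]
      mor_key_deg[OF x y key] unfolding N_def by metis+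
  have a': "?c + a' = meetd (m + a) (pdeg x)" "?e + a' = meetd (p + a) (pdeg y)"
    using fun_add_diff_le[OF meetd_mono[OF le(1), of "pdeg x"]] fun_add_diff_le[OF meetd_mono[OF le(3), of "pdeg y"]]
      arith(1)[OF a] unfolding a'_def by metis+
  have b': "?c + b' = meetd (m + b) (pdeg x)" "?e + b' = meetd (p + b) (pdeg y)"
    using fun_add_diff_le[OF meetd_mono[OF order_trans[OF le(1,2)], of "pdeg x"]]
      fun_add_diff_le[OF meetd_mono[OF order_trans[OF le(3,4)], of "pdeg y"]]
      arith(1)[OF ab(2)] unfolding b'_def by metis+
  have "a' \<le> b'" "b' \<le> N"
    using meetd_mono[OF le(2)] arith(3)[OF ab(2)] by (auto simp: a'_def b'_def N_def le_fun_def diff_le_mono)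
  then have "pmor x (?c + a', ?c + b') = pmor y (?e + a', ?e + b')"
    by (intro path_agree[where N = N]) (use validD(2)[OF x] validD(2)[OF y] N fin_meetd_le k(3) in auto)
  then show ?thesis
    using a' b' arith(2)[OF a] by (simp add: mor_key_def fun_eq_iff)
qed

text \<open>First components compose in \<Lambda> and lengths add, so the key of a composite along
  one path depends only on the keys of its two steps.\<close>

lemma mor_key_join:
  assumes x: "valid x m n" "valid x n t" and y: "valid y p q" "valid y q s"
    and key: "mor_key x m n = mor_key y p q" "mor_key x n t = mor_key y q s"
  shows "mor_key x m t = mor_key y p s"
proof -
  note le = validD(3)[OF x(1)] validD(3)[OF x(2)] validD(3)[OF y(1)] validD(3)[OF y(2)]
  have "t - m = s - p"
  proof -
    have "n - m = q - p" "t - n = s - q"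
      using key by (auto simp: mor_key_def)
    then have "(n - m) + (t - n) = (q - p) + (s - q)"
      by simp
    moreover have "(n - m) + (t - n) = t - m" "(q - p) + (s - q) = s - p"
      using le by (auto simp: le_fun_def fun_eq_iff)
    ultimately show ?thesis
      by simp
  qed
  then show ?thesis
    using key path_cmp[OF validD(2)[OF x(1)] meetd_mono[OF le(1)] meetd_mono[OF le(2)] fin_meetd_le]
      path_cmp[OF validD(2)[OF y(1)] meetd_mono[OF le(3)] meetd_mono[OF le(4)] fin_meetd_le]
    by (simp add: mor_key_def)
qed

text \<open>One boundary path \<open>z\<close> carries both factors as adjacent steps. Equality of
  object keys supplies the common vertex at which to concatenate and also the equal excesses
  required by \<open>meetd_concat\<close>.\<close>

lemma mor_key_concat:
  assumes x: "valid x m n" and y: "valid y p q" and key: "obj_key x n = obj_key y p"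
  defines "z \<equiv> concat_path k \<Lambda> (pmor x (0, meetd n (pdeg x))) (shift k (meetd p (pdeg y)) y)"
  shows "z \<in> bdry" "mor_key z m n = mor_key x m n" "mor_key z n (n + (q - p)) = mor_key y p q"
proof -
  define c where "c = meetd n (pdeg x)"
  define e where "e = meetd p (pdeg y)"
  define u where "u = shift k e y"
  define \<mu> where "\<mu> = pmor x (0, c)"
  have z: "z = concat_path k \<Lambda> \<mu> u"
    by (simp add: z_def \<mu>_def u_def c_def e_def)
  have fc: "fin c \<le> pdeg x" and fe: "fin e \<le> pdeg y"
    by (simp_all add: c_def e_def fin_meetd_le)
  note xp = validD(2)[OF x] and yp = validD(2)[OF y]
  note \<mu> = path_morphism[OF xp fun_zero_le fc, folded \<mu>_def]
  have dmu: "deg \<Lambda> \<mu> = c"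
    using \<mu>(2) by (simp add: fun_eq_iff)
  have k: "n - c = p - e" "pvert \<Lambda> x c = pvert \<Lambda> y e"
    using key by (auto simp: obj_key_def c_def e_def)
  note u = shift_path[OF yp fe, folded u_def]
  have ub: "u \<in> bdry"
    using shift_boundary[OF validD(1)[OF y] fe] by (simp add: u_def)
  have v: "pvert \<Lambda> u 0 = src \<Lambda> \<mu>"
    using u(5)[of 0] fe \<mu>(4) k by simp
  show zb: "z \<in> bdry"
    unfolding z by (rule concat_boundary[OF \<mu>(1) ub v])
  note zp = concat_path[OF \<mu>(1) u(1) v, folded z, unfolded dmu]
  have dz: "pdeg z = fin (meetd n (pdeg x)) + (pdeg y - fin (meetd p (pdeg y)))"
    using zp(2) u(2) by (simp add: c_def e_def)
  note ar = meetd_concat[OF k(1)[unfolded c_def e_def] validD(3)[OF y], folded dz]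
  have c': "meetd n (pdeg z) = c"
    using ar(1)[of n] by (simp add: c_def)
  have fcz: "fin c \<le> pdeg z"
    using fin_meetd_le[of n "pdeg z"] c' by simp
  have "pmor z (meetd m (pdeg x), c) = pmor x (meetd m (pdeg x), c)"
    by (rule path_agree_init[OF zp(1) fcz xp fc])
      (use zp(3) \<mu>_def meetd_mono[OF validD(3)[OF x]] in \<open>auto simp: c_def\<close>)
  then show "mor_key z m n = mor_key x m n"
    using ar(1)[OF validD(3)[OF x]] c' by (simp add: mor_key_def c_def)
  define f where "f = meetd q (pdeg y) - e"
  have f: "f + e = meetd q (pdeg y)"
    using meetd_mono[OF validD(3)[OF y], of "pdeg y"] by (simp add: f_def e_def fun_eq_iff le_fun_def)
  have ff: "fin f \<le> pdeg u"
    using f fin_meetd_le u(2,3) by simp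
  have "pmor z (c + 0, c + f) = pmor u (0, f)"
    by (rule zp(4)[OF fun_zero_le ff])
  also have "\<dots> = pmor y (e, meetd q (pdeg y))"
    using u(4)[OF fun_zero_le, of f] f fin_meetd_le by simp
  finally have "pmor z (c, c + f) = pmor y (e, meetd q (pdeg y))"
    by simp
  moreover have "meetd (n + (q - p)) (pdeg z) = c + f"
    using ar(2) by (simp add: c_def f_def e_def)
  ultimately show "mor_key z n (n + (q - p)) = mor_key y p q"
    using c' k(1) by (simp add: mor_key_def e_def)
qed

section \<open>The structure maps of the desourcification evaluated on representatives\<close>

lemma rng_mcl: "rng des (mcl x m n) = ocl x m" if v: "valid x m n"
proof -
  have "(THE v. \<exists>y p q. (y, p, q) \<in> mcl x m n \<and> v = ocl y p) = ocl x m"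
  proof (rule the_equality)
    show "\<exists>y p q. (y, p, q) \<in> mcl x m n \<and> ocl x m = ocl y p"
      using mem_mcl[OF v] v by blast
    fix w assume "\<exists>y p q. (y, p, q) \<in> mcl x m n \<and> w = ocl y p"
    then obtain y p q where "valid y p q" "mor_key y p q = mor_key x m n" "w = ocl y p"
      using mem_mcl[OF v] by blast
    then show "w = ocl x m"
      using mor_key_ends(1) ocl_eq_iff validD valid_NN v by metis
  qed
  then show ?thesis
    by (simp add: desource_def)
qed

lemma src_mcl: "src des (mcl x m n) = ocl x n" if v: "valid x m n"
proof -
  have "(THE v. \<exists>y p q. (y, p, q) \<in> mcl x m n \<and> v = ocl y q) = ocl x n"
  proof (rule the_equality)
    show "\<exists>y p q. (y, p, q) \<in> mcl x m n \<and> ocl x n = ocl y q"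
      using mem_mcl[OF v] v by blast
    fix w assume "\<exists>y p q. (y, p, q) \<in> mcl x m n \<and> w = ocl y q"
    then obtain y p q where "valid y p q" "mor_key y p q = mor_key x m n" "w = ocl y q"
      using mem_mcl[OF v] by blast
    then show "w = ocl x n"
      using mor_key_ends(2) ocl_eq_iff validD valid_NN v by metis
  qed
  then show ?thesis
    by (simp add: desource_def)
qed

lemma deg_mcl: "deg des (mcl x m n) = n - m" if v: "valid x m n"
proof -
  have "(THE d. \<exists>y p q. (y, p, q) \<in> mcl x m n \<and> d = q - p) = n - m"
  proof (rule the_equality)
    show "\<exists>y p q. (y, p, q) \<in> mcl x m n \<and> n - m = q - p"
      using mem_mcl[OF v] v by blast
    show "d = n - m" if "\<exists>y p q. (y, p, q) \<in> mcl x m n \<and> d = q - p" for d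
      using that mem_mcl[OF v] by (auto simp: mor_key_def)
  qed
  then show ?thesis
    by (simp add: desource_def)
qed

lemma mor_key_idm: "mor_key x m m = mor_key y p p"
  if "x \<in> bdry" "y \<in> bdry" "obj_key x m = obj_key y p"
  using that(3) path_morphism(5)[OF boundary_pathsD(1)[OF that(1)] order_refl fin_meetd_le[of m]]
    path_morphism(5)[OF boundary_pathsD(1)[OF that(2)] order_refl fin_meetd_le[of p]]
  by (simp add: mor_key_def obj_key_def fun_eq_iff)

lemma idm_ocl: "idm des (ocl x m) = mcl x m m" if v: "x \<in> bdry" "m \<in> NN k"
proof -
  have vv: "valid y p p" if "y \<in> bdry" "p \<in> NN k" for y p
    using that by (simp add: valid_def)
  have "(THE c. \<exists>y p. (y, p) \<in> ocl x m \<and> c = mcl y p p) = mcl x m m"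
  proof (rule the_equality)
    show "\<exists>y p. (y, p) \<in> ocl x m \<and> mcl x m m = mcl y p p"
      using mem_ocl[OF v] v by blast
    fix c assume "\<exists>y p. (y, p) \<in> ocl x m \<and> c = mcl y p p"
    then obtain y p where "y \<in> bdry" "p \<in> NN k" "obj_key y p = obj_key x m" "c = mcl y p p"
      using mem_ocl[OF v] by blast
    then show "c = mcl x m m"
      using mor_key_idm mcl_eq_iff vv v by metis
  qed
  then show ?thesis
    by (simp add: desource_def)
qed

text \<open>Every choice of representatives yields, by \<open>mor_key_concat\<close>, a path through
  both factors, and \<open>mor_key_join\<close> shows that all choices give the same composite. The
  path \<open>z\<close> is part of the conclusion so that later arguments can place two arbitrary
  factors on one path.\<close>

lemma cmp_mcl:
  assumes x: "valid x m n" and y: "valid y p q" and eq: "ocl x n = ocl y p"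
  shows "\<exists>z. valid z m n \<and> valid z n (n + (q - p)) \<and> mcl z m n = mcl x m n \<and>
    mcl z n (n + (q - p)) = mcl y p q \<and> cmp des (mcl x m n) (mcl y p q) = mcl z m (n + (q - p))"
proof -
  define cat where "cat x n y p =
    concat_path k \<Lambda> (pmor x (0, meetd n (pdeg x))) (shift k (meetd p (pdeg y)) y)" for x n y p
  have good: "valid (cat x m' y p') m n \<and> valid (cat x m' y p') n (n + (q - p)) \<and>
      mor_key (cat x m' y p') m n = mor_key x m n \<and>
      mor_key (cat x m' y p') n (n + (q - p)) = mor_key y p q"
    if h: "valid x m n" "valid y p q" "ocl x n = ocl y p" "m' = n" "p' = p" for x m n y p q m' p'
  proof -
    have "obj_key x n = obj_key y p"
      using ocl_eq_iff validD(1)[OF h(1)] validD(1)[OF h(2)] valid_NN(2)[OF h(1)] valid_NN(1)[OF h(2)] h(3)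
      by blast
    note c = mor_key_concat[OF h(1,2) this, folded cat_def]
    have "n + (q - p) \<in> NN k"
      using NN_add NN_diff valid_NN(2)[OF h(1)] valid_NN(2)[OF h(2)] by blast
    then show ?thesis
      using c h validD(3)[OF h(1)] valid_NN(2)[OF h(1)] by (simp add: valid_def)
  qed
  define z where "z = cat x n y p"
  have z: "valid z m n" "valid z n (n + (q - p))" "mor_key z m n = mor_key x m n"
    "mor_key z n (n + (q - p)) = mor_key y p q"
    using good[OF x y eq refl refl] by (auto simp: z_def)
  \<comment> \<open>The definition of composition reads (n + q) - p; under truncated subtraction the
    regrouping relies on p \<le> q.\<close>
  have sub: "n + q - p = n + (q - p)" if "valid y p q" for n y p q
    using validD(3)[OF that] by (simp add: fun_eq_iff le_fun_def)
  have "(THE e. \<exists>x' m' n' y' p' q'. (x', m', n') \<in> mcl x m n \<and> (y', p', q') \<in> mcl y p q \<and>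
          ocl x' n' = ocl y' p' \<and> e = mcl (cat x' n' y' p') m' (n' + q' - p')) = mcl z m (n + (q - p))"
  proof (rule the_equality)
    show "\<exists>x' m' n' y' p' q'. (x', m', n') \<in> mcl x m n \<and> (y', p', q') \<in> mcl y p q \<and>
        ocl x' n' = ocl y' p' \<and> mcl z m (n + (q - p)) = mcl (cat x' n' y' p') m' (n' + q' - p')"
      using mem_mcl[OF x, of x m n] mem_mcl[OF y, of y p q] x y eq sub[OF y] z_def by metis
    fix e assume "\<exists>x' m' n' y' p' q'. (x', m', n') \<in> mcl x m n \<and> (y', p', q') \<in> mcl y p q \<and>
        ocl x' n' = ocl y' p' \<and> e = mcl (cat x' n' y' p') m' (n' + q' - p')"
    then obtain x' m' n' y' p' q' where r: "valid x' m' n'" "mor_key x' m' n' = mor_key x m n"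
      "valid y' p' q'" "mor_key y' p' q' = mor_key y p q" "ocl x' n' = ocl y' p'"
      "e = mcl (cat x' n' y' p') m' (n' + q' - p')"
      using mem_mcl[OF x] mem_mcl[OF y] by blast
    define z' where "z' = cat x' n' y' p'"
    have z': "valid z' m' n'" "valid z' n' (n' + (q' - p'))" "mor_key z' m' n' = mor_key x' m' n'"
      "mor_key z' n' (n' + (q' - p')) = mor_key y' p' q'"
      using good[OF r(1,3,5) refl refl] by (auto simp: z'_def)
    have "mor_key z' m' (n' + (q' - p')) = mor_key z m (n + (q - p))"
      by (rule mor_key_join[OF z'(1,2) z(1,2)]) (use z z' r in auto)
    then show "e = mcl z m (n + (q - p))"
      using r(6) sub[OF r(3)] mcl_eq_iff[OF valid_trans[OF z'(1,2)] valid_trans[OF z(1,2)]] by (simp add: z'_def)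
  qed
  then have "cmp des (mcl x m n) (mcl y p q) = mcl z m (n + (q - p))"
    by (simp add: desource_def cat_def)
  then show ?thesis
    using z x y mcl_eq_iff by blast
qed

lemma cmp_mcl_self:
  assumes "valid x m n" "valid x n t"
  shows "cmp des (mcl x m n) (mcl x n t) = mcl x m t"
proof -
  have t: "n + (t - n) = t"
    using fun_add_diff_le validD(3)[OF assms(2)] by blast
  obtain z where z: "valid z m n" "valid z n t" "mcl z m n = mcl x m n" "mcl z n t = mcl x n t"
    "cmp des (mcl x m n) (mcl x n t) = mcl z m t"
    using cmp_mcl[OF assms refl] unfolding t by blast
  have v: "valid x m t" "valid z m t"
    using assms z valid_trans by blast+
  have "mor_key z m t = mor_key x m t"
    by (rule mor_key_join[OF z(1,2) assms]) (use z assms mcl_eq_iff in blast)+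
  then show ?thesis
    using z(5) mcl_eq_iff v by simp
qed

lemma des_idm_left:
  assumes "A \<in> Mor des"
  shows "cmp des (idm des (rng des A)) A = A"
proof -
  obtain x m n where x: "valid x m n" "A = mcl x m n"
    using assms Mor_des by blast
  have "valid x m m"
    using x(1) valid_NN(1)[OF x(1)] by (simp add: valid_def)
  then show ?thesis
    using x rng_mcl idm_ocl validD valid_NN cmp_mcl_self by metis
qed

lemma des_idm_Mor:
  assumes "v \<in> Obj des"
  shows "idm des v \<in> Mor des" "rng des (idm des v) = v" "src des (idm des v) = v" "deg des (idm des v) = 0"
proof -
  obtain x m where x: "x \<in> bdry" "m \<in> NN k" "v = ocl x m"
    using assms by (force simp: desource_def quotient_def obj_pairs_def obj_class_def)
  then have "valid x m m"
    by (simp add: valid_def)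
  then show "idm des v \<in> Mor des" "rng des (idm des v) = v" "src des (idm des v) = v" "deg des (idm des v) = 0"
    using x idm_ocl mcl_Mor rng_mcl src_mcl deg_mcl by (auto simp: fun_eq_iff)
qed

lemma des_cmp_Mor:
  assumes "A \<in> Mor des" "B \<in> Mor des" "src des A = rng des B"
  shows "cmp des A B \<in> Mor des"
proof -
  obtain x m n y p q where *: "valid x m n" "A = mcl x m n" "valid y p q" "B = mcl y p q"
    using assms Mor_des by metis
  then have eq: "ocl x n = ocl y p"
    using assms(3) src_mcl rng_mcl by simp
  obtain z where z: "valid z m n" "valid z n (n + (q - p))" "cmp des A B = mcl z m (n + (q - p))"
    using cmp_mcl[OF *(1,3) eq] * by blast
  then have "valid z m (n + (q - p))"
    using valid_trans by blast
  then show ?thesis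
    using z mcl_Mor by simp
qed

section \<open>The embedding\<close>

lemma mor_key_finite: "m \<le> n \<Longrightarrow> fin n \<le> pdeg x \<Longrightarrow> mor_key x m n = (pmor x (m, n), 0, n - m)"
  using meetd_eq_self[of m "pdeg x"] meetd_eq_self[of n "pdeg x"] fin_le_trans[of m n "pdeg x"]
  by (simp add: mor_key_def)

lemma validI: "x \<in> bdry \<Longrightarrow> m \<le> n \<Longrightarrow> fin n \<le> pdeg x \<Longrightarrow> valid x m n"
  using boundary_pathsD(1)[of x k \<Lambda>] fin_le_pdeg_NN[of x k \<Lambda> n] by (auto simp: valid_def)

text \<open>Every boundary path that begins with \<open>\<mu>\<close> represents \<iota>(\<mu>),
  since its key is (\<mu>, 0, d(\<mu>)) in all cases. The shift of \<open>w\<close> is the witness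
  that the definite description asks for.\<close>

lemma iota_eq:
  assumes w: "w \<in> bdry" "fin (deg \<Lambda> \<mu>) \<le> pdeg w" "pmor w (0, deg \<Lambda> \<mu>) = \<mu>"
  shows "iota k \<Lambda> \<mu> = mcl w 0 (deg \<Lambda> \<mu>)"
proof -
  let ?d = "deg \<Lambda> \<mu>"
  note wp = boundary_pathsD(1)[OF w(1)]
  note \<mu> = path_morphism[OF wp fun_zero_le w(2), unfolded w(3)]
  have cat: "mcl (concat_path k \<Lambda> \<mu> x) 0 ?d = mcl w 0 ?d" if x: "x \<in> bdry" "pvert \<Lambda> x 0 = src \<Lambda> \<mu>" for x
  proof -
    note c = concat_path[OF \<mu>(1) boundary_pathsD(1)[OF x(1)] x(2)]
    have "fin ?d \<le> pdeg (concat_path k \<Lambda> \<mu> x)"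
      by (simp add: c(2) fin_le_add_iff zero_fun_def[symmetric] fun_diff_def)
    from validI[OF concat_boundary[OF \<mu>(1) x] fun_zero_le this] mor_key_finite[OF fun_zero_le this]
    have "valid (concat_path k \<Lambda> \<mu> x) 0 ?d" "mor_key (concat_path k \<Lambda> \<mu> x) 0 ?d = (\<mu>, 0, ?d - 0)"
      by (simp_all add: c(3))
    then show ?thesis
      using mcl_eq_iff validI[OF w(1) fun_zero_le w(2)] mor_key_finite[OF fun_zero_le w(2)] w(3) by simp
  qed
  show ?thesis
    unfolding iota_def
  proof (rule the_equality)
    have "shift k ?d w \<in> bdry" "pvert \<Lambda> (shift k ?d w) 0 = src \<Lambda> \<mu>"
      using shift_boundary[OF w(1,2)] shift_path(5)[OF wp w(2), of 0] w(2) \<mu>(4) by simp_all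
    then show "\<exists>x\<in>bdry. pvert \<Lambda> x 0 = src \<Lambda> \<mu> \<and> mcl w 0 ?d = mcl (concat_path k \<Lambda> \<mu> x) 0 ?d"
      using cat by metis
  qed (use cat in auto)
qed

lemma boundary_path_extends:
  assumes "\<mu> \<in> Mor \<Lambda>"
  shows "\<exists>w\<in>bdry. fin (deg \<Lambda> \<mu>) \<le> pdeg w \<and> pmor w (0, deg \<Lambda> \<mu>) = \<mu>"
proof -
  obtain x where x: "x \<in> bdry" "pvert \<Lambda> x 0 = src \<Lambda> \<mu>"
    using boundary_path_exists src_Obj[OF assms] by blast
  note c = concat_path[OF assms boundary_pathsD(1)[OF x(1)] x(2)]
  have "fin (deg \<Lambda> \<mu>) \<le> pdeg (concat_path k \<Lambda> \<mu> x)"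
    by (simp add: c(2) fin_le_add_iff zero_fun_def[symmetric] fun_diff_def)
  then show ?thesis
    using c(3) concat_boundary[OF assms x] by blast
qed

lemma iota_representative:
  assumes "\<mu> \<in> Mor \<Lambda>"
  obtains w where "valid w 0 (deg \<Lambda> \<mu>)" "fin (deg \<Lambda> \<mu>) \<le> pdeg w" "iota k \<Lambda> \<mu> = mcl w 0 (deg \<Lambda> \<mu>)"
    "mor_key w 0 (deg \<Lambda> \<mu>) = (\<mu>, 0, deg \<Lambda> \<mu>)"
proof -
  obtain w where w: "w \<in> bdry" "fin (deg \<Lambda> \<mu>) \<le> pdeg w" "pmor w (0, deg \<Lambda> \<mu>) = \<mu>"
    using boundary_path_extends[OF assms] by blast
  show thesis
    using that[OF validI[OF w(1) fun_zero_le w(2)] w(2) iota_eq[OF w]] mor_key_finite[OF fun_zero_le w(2)] w(3)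
    by simp
qed

text \<open>If \<open>m\<close> has no excess, the initial part of \<open>y\<close> can be
  discarded, which gives a representative that starts at degree 0.\<close>

lemma mor_key_shift:
  assumes y: "valid y m n" "fin m \<le> pdeg y"
  shows "valid (shift k m y) 0 (n - m)" "mor_key (shift k m y) 0 (n - m) = mor_key y m n"
proof -
  show "valid (shift k m y) 0 (n - m)"
    using shift_boundary[OF validD(1)[OF y(1)] y(2)] NN_diff[OF valid_NN(2)[OF y(1)]] by (simp add: valid_def)
  note s = shift_path[OF validD(2)[OF y(1)] y(2)]
  have "meetd (n - m) (pdeg y - fin m) + m = meetd n (pdeg y)"
  proof
    fix i
    have "m i \<le> n i" "enat (m i) \<le> pdeg y i"
      using validD(3)[OF y(1)] y(2) by (auto simp: le_fun_def fin_def)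
    then show "(meetd (n - m) (pdeg y - fin m) + m) i = meetd n (pdeg y) i"
      by (cases "pdeg y i") (auto simp: fin_def meetd_eq min_def)
  qed
  moreover have "meetd m (pdeg y) = m"
    using y(2) meetd_eq_self by blast
  ultimately show "mor_key (shift k m y) 0 (n - m) = mor_key y m n"
    using s(2) s(4)[OF fun_zero_le, of "meetd (n - m) (pdeg y - fin m)"] fin_meetd_le[of n "pdeg y"]
    by (simp add: mor_key_def)
qed

lemma iota_pmor:
  assumes z: "z \<in> bdry" "p \<le> q" "fin q \<le> pdeg z"
  shows "iota k \<Lambda> (pmor z (p, q)) = mcl z p q"
proof -
  have fp: "fin p \<le> pdeg z"
    using fin_le_trans z by blast
  have v: "valid z p q"
    using validI z by blast
  note s = mor_key_shift[OF v fp]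
  have d: "deg \<Lambda> (pmor z (p, q)) = q - p"
    using path_morphism(2)[OF boundary_pathsD(1)[OF z(1)] z(2,3)] .
  have pq: "q - p + p = q"
    using z(2) by (simp add: fun_eq_iff le_fun_def)
  note sp = shift_path[OF boundary_pathsD(1)[OF z(1)] fp]
  have "iota k \<Lambda> (pmor z (p, q)) = mcl (shift k p z) 0 (q - p)"
    using iota_eq[of "shift k p z" "pmor z (p, q)"] d sp(2,3) sp(4)[OF fun_zero_le, of "q - p"] pq z(3)
      validD(1)[OF s(1)] by simp
  also have "\<dots> = mcl z p q"
    using mcl_eq_iff[OF s(1) v] s(2) by simp
  finally show ?thesis .
qed

text \<open>The excess at the source is an invariant of the class, and it vanishes for
  \<iota>(\<mu>), whose representative runs through all of \<mu>.\<close>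

lemma mcl_in_iota_iff:
  assumes "valid z m n"
  shows "mcl z m n \<in> iota k \<Lambda> ` Mor \<Lambda> \<longleftrightarrow> fin n \<le> pdeg z"
proof
  assume "fin n \<le> pdeg z"
  then show "mcl z m n \<in> iota k \<Lambda> ` Mor \<Lambda>"
    using iota_pmor validD[OF assms] path_morphism(1) by (metis imageI)
next
  assume "mcl z m n \<in> iota k \<Lambda> ` Mor \<Lambda>"
  then obtain \<mu> where mu: "\<mu> \<in> Mor \<Lambda>" "mcl z m n = iota k \<Lambda> \<mu>"
    by blast
  obtain w where w: "valid w 0 (deg \<Lambda> \<mu>)" "fin (deg \<Lambda> \<mu>) \<le> pdeg w" "iota k \<Lambda> \<mu> = mcl w 0 (deg \<Lambda> \<mu>)"
    using iota_representative[OF mu(1)] by blast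
  have "mor_key z m n = mor_key w 0 (deg \<Lambda> \<mu>)"
    using mu(2) w(3) mcl_eq_iff[OF assms w(1)] by simp
  then have "obj_key z n = obj_key w (deg \<Lambda> \<mu>)"
    using mor_key_ends(2)[OF assms w(1)] by blast
  then have "n - meetd n (pdeg z) = 0"
    using meetd_eq_self[OF w(2)] by (simp add: obj_key_def fun_eq_iff)
  then show "fin n \<le> pdeg z"
    by (rule fin_le_if_meetd)
qed

section \<open>Infinite paths in the desourcification\<close>

definition lift_path :: "'m kpath \<Rightarrow> 'm dmor kpath" where
  "lift_path z = KPath (infdeg k) (restrict (\<lambda>(p, q). mcl z p q) (Mor (Omega k (infdeg k))))"

lemma pdeg_lift [simp]: "pdeg (lift_path z) = infdeg k"
  by (simp add: lift_path_def)

lemma pmor_lift: "p \<le> q \<Longrightarrow> q \<in> NN k \<Longrightarrow> pmor (lift_path z) (p, q) = mcl z p q"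
  using NN_mono by (auto simp: lift_path_def Omega_def fin_le_infdeg)

lemma lift_path_space:
  assumes z: "z \<in> bdry"
  shows "lift_path z \<in> path_space k des"
proof -
  have "KPath (infdeg k) (pmor (lift_path z)) \<in> path_space k des"
  proof (rule path_spaceI[where f = "ocl z"])
    show "pmor (lift_path z) \<in> extensional (Mor (Omega k (infdeg k)))"
      by (simp add: lift_path_def)
    show "ocl z p \<in> Obj des \<and> pmor (lift_path z) (p, p) = idm des (ocl z p)" if "fin p \<le> infdeg k" for p
      using that z ocl_Obj idm_ocl pmor_lift by (simp add: fin_le_infdeg)
    show "pmor (lift_path z) (p, q) \<in> Mor des \<and> rng des (pmor (lift_path z) (p, q)) = ocl z p \<and>
        src des (pmor (lift_path z) (p, q)) = ocl z q \<and> deg des (pmor (lift_path z) (p, q)) = q - p"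
      if "p \<le> q" "fin q \<le> infdeg k" for p q
    proof -
      have q: "q \<in> NN k" and v: "valid z p q"
        using that z by (auto simp: fin_le_infdeg valid_def)
      show ?thesis
        unfolding pmor_lift[OF that(1) q] using v mcl_Mor rng_mcl src_mcl deg_mcl by blast
    qed
    show "cmp des (pmor (lift_path z) (p, q)) (pmor (lift_path z) (q, t)) = pmor (lift_path z) (p, t)"
      if "p \<le> q" "q \<le> t" "fin t \<le> infdeg k" for p q t
    proof -
      have q: "q \<in> NN k" and t: "t \<in> NN k" and v: "valid z p q" "valid z q t"
        using that z NN_mono by (auto simp: fin_le_infdeg valid_def)
      show ?thesis
        unfolding pmor_lift[OF that(1) q] pmor_lift[OF that(2) t] pmor_lift[OF order_trans[OF that(1,2)] t]
        using cmp_mcl_self[OF v] .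
    qed
  qed simp
  then show ?thesis
    by (simp add: lift_path_def)
qed

lemma lift_embedded:
  assumes z: "z \<in> bdry"
  shows "lift_path z \<in> embedded_inf_paths k \<Lambda>"
proof -
  have "lift_path z \<in> inf_paths k des"
    using lift_path_space[OF z] unfolding inf_paths_def
    by (force simp: path_space_def paths_of_degree_def)
  moreover have "pmor (lift_path z) (0, 0) = iota k \<Lambda> (pmor z (0, 0))"
    using pmor_lift iota_pmor[OF z order_refl fin_zero_le] by simp
  moreover have "pmor z (0, 0) \<in> vertices \<Lambda>"
    using path_morphism(1,2)[OF boundary_pathsD(1)[OF z] order_refl fin_zero_le]
    by (simp add: vertices_def fun_eq_iff)
  ultimately show ?thesis
    by (simp add: embedded_inf_paths_def)
qed

section \<open>Every infinite path with range in the image of the vertices comes from a boundary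
  path\<close>

lemma embeddedD:
  assumes "X \<in> embedded_inf_paths k \<Lambda>"
  shows "X \<in> path_space k des" "pdeg X = infdeg k" "pmor X (0, 0) \<in> iota k \<Lambda> ` vertices \<Lambda>"
  using assms by (auto simp: embedded_inf_paths_def inf_paths_def path_space_def paths_of_degree_def)

text \<open>Representatives of X(0,a) and X(a,q) are placed on a common path by
  \<open>cmp_mcl\<close>; their composite has the same key as the step of \<open>y\<close> from 0 to
  q, and \<open>mor_key_factor\<close> then identifies the two pieces.\<close>

lemma initial_class_determines:
  assumes X: "X \<in> path_space k des" "pdeg X = infdeg k"
    and y: "y \<in> bdry" "q \<in> NN k" "pmor X (0, q) = mcl y 0 q" and ab: "a \<le> b" "b \<le> q"
  shows "pmor X (a, b) = mcl y a b"
proof -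
  have aux: "pmor X (0, a) = mcl y 0 a \<and> pmor X (a, q) = mcl y a q"
    if y: "q \<in> NN k" "pmor X (0, q) = mcl y 0 q" and a: "a \<le> q" for a q
  proof -
    have fq: "fin q \<le> pdeg X"
      using y(1) X(2) by (simp add: fin_le_infdeg)
    then have fa: "fin a \<le> pdeg X"
      using fin_le_trans a by blast
    note Xa = path_morphism[OF X(1) fun_zero_le fa] and Xq = path_morphism[OF X(1) a fq]
    obtain x m n where x: "valid x m n" "pmor X (0, a) = mcl x m n"
      using Xa(1) Mor_des by blast
    obtain u p t where u: "valid u p t" "pmor X (a, q) = mcl u p t"
      using Xq(1) Mor_des by blast
    have d: "n - m = a" "t - p = q - a"
      using Xa(2) Xq(2) deg_mcl x u by (auto simp: fun_eq_iff)
    have "ocl x n = ocl u p"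
      using Xa(4) Xq(3) x u src_mcl rng_mcl by metis
    from cmp_mcl[OF x(1) u(1) this] obtain z where z: "valid z m n" "valid z n (n + (q - a))"
      "mcl z m n = pmor X (0, a)" "mcl z n (n + (q - a)) = pmor X (a, q)"
      "cmp des (pmor X (0, a)) (pmor X (a, q)) = mcl z m (n + (q - a))"
      unfolding d x(2)[symmetric] u(2)[symmetric] by blast
    have eq: "mcl z m (n + (q - a)) = mcl y 0 q"
      using z(5) path_cmp[OF X(1) fun_zero_le a fq] y(2) by simp
    have vy: "valid y 0 q" "valid y 0 a" "valid y a q"
      using \<open>y \<in> bdry\<close> y(1) a NN_mono by (auto simp: valid_def)
    have n: "m + a = n" "m + q = n + (q - a)"
    proof -
      show "m + a = n"
        using d(1) fun_add_diff_le[OF validD(3)[OF x(1)]] by simp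
      then show "m + q = n + (q - a)"
        using fun_add_diff_le[OF a] by (metis add.assoc)
    qed
    then have q: "n + (q - a) - m = q"
      by (metis fun_add_diff_cancel)
    have key: "mor_key z m (n + (q - a)) = mor_key y 0 q"
      using eq mcl_eq_iff[OF valid_trans[OF z(1,2)] vy(1)] by simp
    note fac = mor_key_factor[OF valid_trans[OF z(1,2)] vy(1) key, unfolded q]
    have "mor_key z m n = mor_key y 0 a"
      using fac[OF fun_zero_le a] n by simp
    moreover have "mor_key z n (n + (q - a)) = mor_key y a q"
      using fac[OF a order_refl] n by simp
    ultimately show ?thesis
      using mcl_eq_iff[OF z(1) vy(2)] mcl_eq_iff[OF z(2) vy(3)] z(3,4) by simp
  qed
  \<comment> \<open>\<open>aux\<close> is applied twice: here to shorten from \<open>q\<close> to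
    \<open>b\<close>, and below to remove the part up to \<open>a\<close>.\<close>
  have "b \<in> NN k" "pmor X (0, b) = mcl y 0 b"
    using aux[OF y(2,3) ab(2)] NN_mono[OF y(2) ab(2)] by auto
  then show ?thesis
    using aux ab(1) by blast
qed

text \<open>The condition on the range enters here: a vertex in the image of \<iota> has zero
  excess, so a representative of X(0,q) starts at a degree m \<le> d(y) and can be shifted to start
  at 0.\<close>

lemma initial_class_exists:
  assumes X: "X \<in> embedded_inf_paths k \<Lambda>" and q: "q \<in> NN k"
  shows "\<exists>y\<in>bdry. pmor X (0, q) = mcl y 0 q"
proof -
  note Xp = embeddedD[OF X]
  have fq: "fin q \<le> pdeg X"
    using q Xp(2) by (simp add: fin_le_infdeg)
  note Xq = path_morphism[OF Xp(1) fun_zero_le fq]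
  obtain y m n where y: "valid y m n" "pmor X (0, q) = mcl y m n"
    using Xq(1) Mor_des by blast
  have d: "n - m = q"
    using Xq(2) deg_mcl y by (simp add: fun_eq_iff)
  obtain v where v: "v \<in> Mor \<Lambda>" "deg \<Lambda> v = 0" "pmor X (0, 0) = iota k \<Lambda> v"
    using Xp(3) by (auto simp: vertices_def)
  obtain w where w: "valid w 0 0" "pmor X (0, 0) = mcl w 0 0"
    using iota_representative[OF v(1)] v(2,3) by metis
  have "ocl y m = ocl w 0"
    using Xq(3) rng_mcl y w by (simp add: pvert_def)
  then have "obj_key y m = obj_key w 0"
    using ocl_eq_iff[of y m w 0] validD(1) valid_NN y w by simp
  then have "m - meetd m (pdeg y) = 0"
    by (simp add: obj_key_def fun_eq_iff)
  then have "fin m \<le> pdeg y"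
    by (rule fin_le_if_meetd)
  note s = mor_key_shift[OF y(1) this]
  show ?thesis
    using s mcl_eq_iff[OF s(1) y(1)] validD(1)[OF s(1)] y(2) d by auto
qed

text \<open>The constant degrees (j, ..., j) form a cofinal sequence in \<open>NN k\<close>, so a
  chain indexed by natural numbers suffices and \<open>path_of_chain\<close> applies.\<close>

definition cube :: "nat \<Rightarrow> nat \<Rightarrow> nat" where
  "cube j = (\<lambda>i. if i < k then j else 0)"

lemma cube_NN [simp]: "cube j \<in> NN k"
  by (simp add: cube_def NN_def)

lemma cube_mono: "i \<le> j \<Longrightarrow> cube i \<le> cube j"
  by (simp add: cube_def le_fun_def)

lemma cube_cofinal:
  assumes "finite P" "P \<subseteq> NN k"
  shows "\<exists>j. \<forall>p\<in>P. p \<le> cube j"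
proof -
  have one: "\<exists>j. p \<le> cube j" if "p \<in> NN k" for p
  proof -
    have "p i \<le> (\<Sum>i<k. p i)" if "i < k" for i
      using that by (intro member_le_sum) auto
    then show ?thesis
      using that by (intro exI[of _ "\<Sum>i<k. p i"]) (auto simp: cube_def le_fun_def NN_def not_less)
  qed
  show ?thesis
    using assms
  proof (induction P rule: finite_induct)
    case (insert p P)
    obtain i where "p \<le> cube i"
      using one insert by blast
    moreover obtain j where "\<forall>p\<in>P. p \<le> cube j"
      using insert by blast
    ultimately show ?case
      using cube_mono[of i "max i j"] cube_mono[of j "max i j"] order_trans
      by (intro exI[of _ "max i j"]) fastforce
  qed auto
qed

lemma lift_surj:
  assumes X: "X \<in> embedded_inf_paths k \<Lambda>"
  shows "\<exists>z\<in>bdry. lift_path z = X"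
proof -
  note Xp = embeddedD[OF X]
  obtain y where y: "\<And>j. y j \<in> bdry" "\<And>j. pmor X (0, cube j) = mcl (y j) 0 (cube j)"
    using initial_class_exists[OF X cube_NN] by metis
  define \<delta> where "\<delta> j = meetd (cube j) (pdeg (y j))" for j
  define \<kappa> where "\<kappa> j = pmor (y j) (0, \<delta> j)" for j
  note yp = boundary_pathsD(1)[OF y(1)]
  have f\<delta>: "fin (\<delta> j) \<le> pdeg (y j)" for j
    by (simp add: \<delta>_def fin_meetd_le)
  have deg\<kappa>: "deg \<Lambda> (\<kappa> j) = \<delta> j" for j
    using path_morphism(2)[OF yp fun_zero_le f\<delta>] by (simp add: \<kappa>_def fun_eq_iff)
  have key: "mor_key (y j) 0 (cube i) = mor_key (y i) 0 (cube i)" if "i \<le> j" for i j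
  proof -
    have "mcl (y j) 0 (cube i) = mcl (y i) 0 (cube i)"
      using initial_class_determines[OF Xp(1,2) y(1) cube_NN y(2) fun_zero_le cube_mono[OF that]] y(2) by simp
    then show ?thesis
      using mcl_eq_iff y(1) by (simp add: valid_def)
  qed
  \<comment> \<open>The truncated length is the degree of the first component of the key, so equal
    keys force all later paths to be cut at the same place below \<open>cube i\<close>.\<close>
  have \<delta>_eq: "meetd (cube i) (pdeg (y j)) = \<delta> i" if "i \<le> j" for i j
    using mor_key_deg[OF _ _ key[OF that]] y(1) by (simp add: valid_def \<delta>_def fun_eq_iff)
  have \<kappa>_eq: "pmor (y j) (0, \<delta> i) = \<kappa> i" if "i \<le> j" for i j
    using key[OF that] \<delta>_eq[OF that] by (simp add: mor_key_def \<kappa>_def \<delta>_def)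
  have \<delta>_mono: "\<delta> i \<le> \<delta> j" if "i \<le> j" for i j
    using meetd_mono[OF cube_mono[OF that], of "pdeg (y j)"] \<delta>_eq[OF that] by (simp add: \<delta>_def)
  have "pre (\<kappa> j) (\<kappa> (Suc j))" for j
    using path_prefix[OF yp fun_zero_le \<delta>_mono f\<delta>, of j "Suc j"] \<kappa>_eq[of j "Suc j"] by (simp add: \<kappa>_def)
  from path_of_chain[of \<kappa>, OF this, unfolded deg\<kappa>]
  obtain z where z: "z \<in> path_space k \<Lambda>" "\<And>j. fin (\<delta> j) \<le> pdeg z" "\<And>j. pmor z (0, \<delta> j) = \<kappa> j"
    "\<And>p. fin p \<le> pdeg z \<Longrightarrow> \<exists>j. p \<le> \<delta> j"
    by blast
  \<comment> \<open>No length is gained in the limit: a degree below \<open>cube j\<close> and d(z)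
    is reached at some stage, and from stage j on the truncation of \<open>cube j\<close> is
    constant. Hence \<open>z\<close> and \<open>y j\<close> have the same key up to
    \<open>cube j\<close>.\<close>
  have meet_z: "meetd (cube j) (pdeg z) = \<delta> j" for j
  proof (rule order_antisym)
    let ?r = "meetd (cube j) (pdeg z)"
    obtain l where "?r \<le> \<delta> l"
      using z(4) fin_meetd_le by blast
    then have "?r \<le> \<delta> (max l j)"
      using \<delta>_mono[of l "max l j"] by (auto intro: order_trans)
    then have "?r \<le> meetd (cube j) (pdeg (y (max l j)))"
      using meetd_le le_meetd f\<delta> fin_le_trans by blast
    then show "?r \<le> \<delta> j"
      using \<delta>_eq[of j "max l j"] by simp
    show "\<delta> j \<le> ?r"
      by (rule le_meetd) (use z(2) in \<open>auto simp: \<delta>_def meetd_le\<close>)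
  qed
  have zb: "z \<in> bdry"
  proof (rule boundary_pathsI[OF z(1)])
    fix n E assume n: "fin n \<le> pdeg z" and E: "E \<in> FE \<Lambda> (pvert \<Lambda> z n)"
    \<comment> \<open>Finiteness of \<open>E\<close> puts all possible end degrees under one cube.
      The member of \<open>E\<close> found on \<open>y j\<close> therefore ends within
      \<open>\<delta> j\<close>, where \<open>y j\<close> and \<open>z\<close> agree.\<close>
    have fin: "finite (insert n ((\<lambda>\<nu>. n + deg \<Lambda> \<nu>) ` E))"
      using E by (simp add: FE_def)
    have nN: "n \<in> NN k"
      using fin_le_pdeg_NN[OF z(1) n] .
    then have "insert n ((\<lambda>\<nu>. n + deg \<Lambda> \<nu>) ` E) \<subseteq> NN k"
      using E deg_NN NN_add by (auto simp: FE_def exhaustive_def paths_from_def)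
    from cube_cofinal[OF fin this] obtain j where j: "n \<le> cube j" "\<And>\<nu>. \<nu> \<in> E \<Longrightarrow> n + deg \<Lambda> \<nu> \<le> cube j"
      by auto
    have n\<delta>: "n \<le> \<delta> j"
      using le_meetd[OF j(1) n] meet_z by simp
    have agree: "pmor (y j) (a, b) = pmor z (a, b)" if "a \<le> b" "b \<le> \<delta> j" for a b
      by (rule path_agree_init[OF yp f\<delta> z(1) z(2) _ that]) (simp add: z(3) \<kappa>_def)
    have ny: "fin n \<le> pdeg (y j)"
      using fin_le_trans[OF n\<delta> f\<delta>] .
    have "pvert \<Lambda> (y j) n = pvert \<Lambda> z n"
      using agree[OF order_refl n\<delta>] by (simp add: pvert_def)
    then obtain m where m: "n \<le> m" "fin m \<le> pdeg (y j)" "pmor (y j) (n, m) \<in> E"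
      using boundary_pathsD(2)[OF y(1) ny] E by metis
    have "n + deg \<Lambda> (pmor (y j) (n, m)) = m"
      using path_morphism(2)[OF yp m(1,2)] fun_add_diff_le[OF m(1)] by simp
    then have "m \<le> \<delta> j"
      using j(2)[OF m(3)] le_meetd m(2) by (simp add: \<delta>_def)
    then show "\<exists>m. n \<le> m \<and> fin m \<le> pdeg z \<and> pmor z (n, m) \<in> E"
      using m agree fin_le_trans[OF _ z(2)] by metis
  qed
  have X_cube: "pmor X (0, cube j) = mcl z 0 (cube j)" for j
  proof -
    have "mor_key z 0 (cube j) = mor_key (y j) 0 (cube j)"
      using meet_z z(3) by (simp add: mor_key_def \<kappa>_def \<delta>_def)
    then show ?thesis
      using mcl_eq_iff[of z 0 "cube j" "y j" 0 "cube j"] zb y by (simp add: valid_def)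
  qed
  have "lift_path z = X"
  proof (rule path_eqI[OF lift_path_space[OF zb] Xp(1)])
    show "pdeg (lift_path z) = pdeg X"
      using Xp(2) by simp
    fix p q assume pq: "p \<le> q" "fin q \<le> pdeg (lift_path z)"
    then have q: "q \<in> NN k"
      by (simp add: fin_le_infdeg)
    then obtain j where "q \<le> cube j"
      using cube_cofinal[of "{q}"] by auto
    then show "pmor (lift_path z) (p, q) = pmor X (p, q)"
      using initial_class_determines[OF Xp(1,2) zb cube_NN X_cube pq(1)] pmor_lift[OF pq(1) q] by simp
  qed
  then show ?thesis
    using zb by blast
qed

section \<open>The projection of a lifted boundary path, and injectivity of the embedding\<close>

lemma proj_lift:
  assumes z: "z \<in> bdry"
  shows "proj k \<Lambda> (lift_path z) = iota_path k \<Lambda> z" "iota_path k \<Lambda> z \<in> path_space k des"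
proof -
  note zp = boundary_pathsD(1)[OF z]
  have "{p \<in> NN k. pmor (lift_path z) (0, p) \<in> iota k \<Lambda> ` Mor \<Lambda>} = {p. fin p \<le> pdeg z}"
  proof -
    have "pmor (lift_path z) (0, p) \<in> iota k \<Lambda> ` Mor \<Lambda> \<longleftrightarrow> fin p \<le> pdeg z" if "p \<in> NN k" for p
      using pmor_lift[OF fun_zero_le that] mcl_in_iota_iff[of z 0 p] z that by (simp add: valid_def)
    then show ?thesis
      using fin_le_pdeg_NN[OF zp] by blast
  qed
  then have pd: "proj_deg k \<Lambda> (lift_path z) = pdeg z"
    by (simp add: proj_deg_def SUP_fin)
  have le: "pdeg z \<le> infdeg k"
    using pdeg_NNinf[OF zp] by (simp add: infdeg_def NNinf_def le_fun_def)
  have "restrict (pmor (lift_path z)) (Mor (Omega k (pdeg z))) =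
      restrict (\<lambda>(p, q). iota k \<Lambda> (pmor z (p, q))) (Mor (Omega k (pdeg z)))"
    by (rule restrict_ext) (auto simp: Omega_def pmor_lift iota_pmor[OF z])
  then show eq: "proj k \<Lambda> (lift_path z) = iota_path k \<Lambda> z"
    by (simp add: proj_def pd restrict_path_def iota_path_def)
  \<comment> \<open>Functoriality of \<iota>(z) is inherited from \<open>lift_path z\<close>, of
    which it is a restriction.\<close>
  show "iota_path k \<Lambda> z \<in> path_space k des"
    using restrict_path(1)[OF lift_path_space[OF z] pdeg_NNinf[OF zp]] le eq pd by (simp add: proj_def)
qed

lemma pmor_iota_path:
  assumes "z \<in> bdry" "p \<le> q" "fin q \<le> pdeg z"
  shows "pmor (iota_path k \<Lambda> z) (p, q) = mcl z p q"
  using assms fin_le_pdeg_NN[OF boundary_pathsD(1)[OF assms(1)]] fin_le_trans iota_pmor[OF assms]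
  by (auto simp: iota_path_def Omega_def)

lemma inj_iota_path: "inj_on (iota_path k \<Lambda>) bdry"
proof (rule inj_onI)
  fix z z' assume z: "z \<in> bdry" "z' \<in> bdry" and eq: "iota_path k \<Lambda> z = iota_path k \<Lambda> z'"
  have pd: "pdeg z = pdeg z'"
    using eq by (simp add: iota_path_def)
  show "z = z'"
  proof (rule path_eqI[OF boundary_pathsD(1)[OF z(1)] boundary_pathsD(1)[OF z(2)] pd])
    fix p q assume pq: "p \<le> q" "fin q \<le> pdeg z"
    then have "mcl z p q = mcl z' p q"
      using pmor_iota_path z eq pd by metis
    then have "mor_key z p q = mor_key z' p q"
      using mcl_eq_iff validI z pq pd by simp
    then show "pmor z (p, q) = pmor z' (p, q)"
      using mor_key_finite[OF pq] mor_key_finite[OF pq(1), of z'] pq(2) pd by simp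
  qed
qed

section \<open>Cylinder sets\<close>

abbreviation "cyl \<equiv> cylinder k des"
abbreviation "Top \<equiv> path_topology k des"

text \<open>The cylinder of its own range is an open neighbourhood of every path; it is used to
  compute the underlying space and to separate a path from a cylinder that misses it.\<close>

lemma in_cyl_range: "X \<in> path_space k des \<Longrightarrow> pmor X (0, 0) = idm des (pvert des X 0) \<and>
    pvert des X 0 \<in> Obj des \<and> X \<in> cyl (pmor X (0, 0))"
  using path_morphism[OF _ order_refl fin_zero_le, of X k des] des_idm_Mor(4)
  by (auto simp: cylinder_def)

lemma cyl_rng: "X \<in> cyl A \<Longrightarrow> pvert des X 0 = rng des A"
  using path_morphism(3)[OF _ fun_zero_le] by (fastforce simp: cylinder_def)

lemma open_cylinder_minus:
  "A \<in> Mor des \<Longrightarrow> finite G \<Longrightarrow> G \<subseteq> paths_from des (src des A) \<Longrightarrow> openin Top (cylinder_minus k des A G)"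
  unfolding path_topology_def by (rule topology_generated_by_Basis) blast

lemma open_cyl: "A \<in> Mor des \<Longrightarrow> openin Top (cyl A)"
  using open_cylinder_minus[of A "{}"] by (simp add: cylinder_minus_def)

lemma topspace_Top: "topspace Top = path_space k des"
proof
  show "topspace Top \<subseteq> path_space k des"
    by (auto simp: path_topology_def topology_generated_by_topspace cylinder_minus_def cylinder_def)
  show "path_space k des \<subseteq> topspace Top"
    using in_cyl_range des_idm_Mor(1) open_cyl openin_subset by fastforce
qed

text \<open>For a path outside the cylinder of \<open>A\<close>, start from the cylinder of its
  range v. If \<open>A\<close> has range v, removing the cylinder of \<open>A\<close> leaves a basic
  open set; otherwise the two cylinders are disjoint because their paths have different
  ranges.\<close>

lemma closed_cyl:
  assumes A: "A \<in> Mor des"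
  shows "closedin Top (cyl A)"
proof -
  have "openin Top (path_space k des - cyl A)"
  proof (subst openin_subopen, rule ballI)
    fix X assume X: "X \<in> path_space k des - cyl A"
    define v where "v = pvert des X 0"
    have v: "v \<in> Obj des" "X \<in> cyl (idm des v)"
      using in_cyl_range[of X] X by (auto simp: v_def)
    note I = des_idm_Mor[OF v(1)]
    show "\<exists>U. openin Top U \<and> X \<in> U \<and> U \<subseteq> path_space k des - cyl A"
    proof (cases "rng des A = v")
      case True
      then have "cmp des (idm des v) A = A"
        using des_idm_left[OF A] by simp
      then have "cylinder_minus k des (idm des v) {A} = cyl (idm des v) - cyl A"
        by (simp add: cylinder_minus_def)
      moreover have "openin Top (cylinder_minus k des (idm des v) {A})"
        by (rule open_cylinder_minus) (use I A True in \<open>auto simp: paths_from_def\<close>)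
      moreover have "cyl (idm des v) \<subseteq> path_space k des"
        by (auto simp: cylinder_def)
      ultimately show ?thesis
        using X v by auto
    next
      case False
      have "cyl (idm des v) \<subseteq> path_space k des"
        by (auto simp: cylinder_def)
      moreover have "Y \<notin> cyl A" if "Y \<in> cyl (idm des v)" for Y
        using cyl_rng[OF that] cyl_rng[of Y A] I(2) False by metis
      ultimately have "cyl (idm des v) \<subseteq> path_space k des - cyl A"
        by blast
      then show ?thesis
        using open_cyl[OF I(1)] v(2) by blast
    qed
  qed
  then show ?thesis
    by (auto simp: closedin_def topspace_Top cylinder_def)
qed

text \<open>A basic open set is one cylinder minus finitely many others, so clopen preimages of
  cylinders suffice. Both directions of the homeomorphism are reduced to this criterion.\<close>

lemma continuous_map_cylinders:
  assumes f: "f \<in> topspace Y \<rightarrow> path_space k des"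
    and clopen: "\<And>A. A \<in> Mor des \<Longrightarrow>
      openin Y {y \<in> topspace Y. f y \<in> cyl A} \<and> closedin Y {y \<in> topspace Y. f y \<in> cyl A}"
  shows "continuous_map Y Top f"
proof -
  have "openin Y (f -` cylinder_minus k des A G \<inter> topspace Y)"
    if h: "A \<in> Mor des" "finite G" "G \<subseteq> paths_from des (src des A)" for A G
  proof -
    have "f -` cylinder_minus k des A G \<inter> topspace Y = {y \<in> topspace Y. f y \<in> cyl A} -
        \<Union>((\<lambda>B. {y \<in> topspace Y. f y \<in> cyl (cmp des A B)}) ` G)"
      by (auto simp: cylinder_minus_def)
    moreover have "closedin Y (\<Union>((\<lambda>B. {y \<in> topspace Y. f y \<in> cyl (cmp des A B)}) ` G))"
      using h clopen des_cmp_Mor by (intro closedin_Union) (auto simp: paths_from_def)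
    ultimately show ?thesis
      using clopen[OF h(1)] by (simp add: openin_diff)
  qed
  moreover have "f ` topspace Y \<subseteq> topspace Top"
    using f topspace_Top by auto
  ultimately show ?thesis
    unfolding path_topology_def continuous_on_generated_topo_iff topology_generated_by_topspace
    by (auto simp: topology_generated_by_topspace)
qed

section \<open>Cylinders met by lifted and by embedded boundary paths\<close>

lemma deg_des_NN: "A \<in> Mor des \<Longrightarrow> deg des A \<in> NN k"
  using Mor_des deg_mcl valid_NN NN_diff by metis

lemma lift_in_cyl:
  assumes "z \<in> bdry" "A \<in> Mor des"
  shows "lift_path z \<in> cyl A \<longleftrightarrow> mcl z 0 (deg des A) = A"
  using lift_path_space[OF assms(1)] deg_des_NN[OF assms(2)] pmor_lift[OF fun_zero_le]
  by (simp add: cylinder_def fin_le_infdeg)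

text \<open>Compared with \<open>lift_in_cyl\<close> only the bound on the degree is new; this is
  the whole effect of \<pi> on cylinders.\<close>

lemma iota_path_in_cyl:
  assumes "z \<in> bdry"
  shows "iota_path k \<Lambda> z \<in> cyl A \<longleftrightarrow> fin (deg des A) \<le> pdeg z \<and> mcl z 0 (deg des A) = A"
proof -
  have "pdeg (iota_path k \<Lambda> z) = pdeg z"
    by (simp add: iota_path_def)
  then show ?thesis
    using proj_lift(2)[OF assms] pmor_iota_path[OF assms fun_zero_le]
    by (simp add: cylinder_def cong: conj_cong)
qed

lemma iota_path_in_cyl_iota:
  assumes z: "z \<in> bdry" and mu: "\<mu> \<in> Mor \<Lambda>"
  shows "iota_path k \<Lambda> z \<in> cyl (iota k \<Lambda> \<mu>) \<longleftrightarrow> fin (deg \<Lambda> \<mu>) \<le> pdeg z \<and> pmor z (0, deg \<Lambda> \<mu>) = \<mu>"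
proof -
  obtain w where w: "valid w 0 (deg \<Lambda> \<mu>)" "iota k \<Lambda> \<mu> = mcl w 0 (deg \<Lambda> \<mu>)"
    "mor_key w 0 (deg \<Lambda> \<mu>) = (\<mu>, 0, deg \<Lambda> \<mu>)"
    using iota_representative[OF mu] by blast
  have d: "deg des (iota k \<Lambda> \<mu>) = deg \<Lambda> \<mu>"
    using w(1,2) deg_mcl by (simp add: fun_eq_iff)
  have "mcl z 0 (deg \<Lambda> \<mu>) = iota k \<Lambda> \<mu> \<longleftrightarrow> pmor z (0, deg \<Lambda> \<mu>) = \<mu>" if f: "fin (deg \<Lambda> \<mu>) \<le> pdeg z"
    using mcl_eq_iff[OF validI[OF z fun_zero_le f] w(1)] w(2,3) mor_key_finite[OF fun_zero_le f]
    by (simp add: fun_eq_iff)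
  then show ?thesis
    using iota_path_in_cyl[OF z] d by auto
qed

lemma iota_Mor: "\<mu> \<in> Mor \<Lambda> \<Longrightarrow> iota k \<Lambda> \<mu> \<in> Mor des"
  using iota_representative mcl_Mor by metis

section \<open>Continuity of \<pi> and of its inverse\<close>

lemma continuous_proj: "continuous_map (subtopology Top (embedded_inf_paths k \<Lambda>)) Top (proj k \<Lambda>)"
    (is "continuous_map ?Y _ _")
proof (rule continuous_map_cylinders)
  have Y: "topspace ?Y = embedded_inf_paths k \<Lambda>"
    using topspace_Top embeddedD(1) by auto
  show "proj k \<Lambda> \<in> topspace ?Y \<rightarrow> path_space k des"
  proof
    fix X assume "X \<in> topspace ?Y"
    then obtain z where "z \<in> bdry" "lift_path z = X"
      using lift_surj Y by blast
    then show "proj k \<Lambda> X \<in> path_space k des"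
      using proj_lift by metis
  qed
  fix A assume A: "A \<in> Mor des"
  \<comment> \<open>Once A = [z;(0,d(A))], the bound d(A) \<le> d(z) from
    \<open>iota_path_in_cyl\<close> says by \<open>mcl_in_iota_iff\<close> that \<open>A\<close>
    lies in \<iota>(\<Lambda>), a condition independent of z.\<close>
  let ?W = "if A \<in> iota k \<Lambda> ` Mor \<Lambda> then cyl A else {}"
  have "proj k \<Lambda> X \<in> cyl A \<longleftrightarrow> X \<in> ?W" if X: "X \<in> embedded_inf_paths k \<Lambda>" for X
  proof -
    obtain z where z: "z \<in> bdry" "lift_path z = X"
      using lift_surj[OF X] by blast
    have v: "valid z 0 (deg des A)"
      using z deg_des_NN[OF A] by (simp add: valid_def)
    show ?thesis
      using mcl_in_iota_iff[OF v] lift_in_cyl[OF z(1) A] iota_path_in_cyl[OF z(1), of A]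
        proj_lift(1)[OF z(1)] z(2) by auto
  qed
  then have eq: "{X \<in> topspace ?Y. proj k \<Lambda> X \<in> cyl A} = embedded_inf_paths k \<Lambda> \<inter> ?W"
    using Y by auto
  have "openin Top ?W" "closedin Top ?W"
    using open_cyl closed_cyl A by auto
  then show "openin ?Y {X \<in> topspace ?Y. proj k \<Lambda> X \<in> cyl A} \<and>
      closedin ?Y {X \<in> topspace ?Y. proj k \<Lambda> X \<in> cyl A}"
    unfolding eq by (simp add: openin_subtopology_Int2 closedin_subtopology_Int_closed)
qed

lemma initial_class_clopen:
  assumes y: "y \<in> bdry" and p: "p \<in> NN k"
  obtains W where "openin Top W" "closedin Top W"
    "\<And>z. z \<in> bdry \<Longrightarrow> iota_path k \<Lambda> z \<in> W \<longleftrightarrow> mcl z 0 p = mcl y 0 p"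
proof -
  define l where "l = pmor y (0, meetd p (pdeg y))"
  define e where "e i = (\<lambda>j. if j = i then 1 else 0 :: nat)" for i :: nat
  \<comment> \<open>The indices are the directions in which the truncation cut something off, that
    is d(y)_i < p_i. In the other directions \<open>l\<close> already reaches p, and what a path
    does beyond p does not affect its class.\<close>
  define K where "K = (\<Union>i\<in>{i. i < k \<and> deg \<Lambda> l i < p i}.
    cmp \<Lambda> l ` {\<alpha> \<in> paths_from \<Lambda> (src \<Lambda> l). deg \<Lambda> \<alpha> = e i})"
  define W where "W = cyl (iota k \<Lambda> l) - \<Union>((\<lambda>\<mu>. cyl (iota k \<Lambda> \<mu>)) ` K)"
  note l = path_morphism[OF boundary_pathsD(1)[OF y] fun_zero_le fin_meetd_le[of p], folded l_def]
  have dl: "deg \<Lambda> l = meetd p (pdeg y)"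
    using l(2) by (simp add: fun_eq_iff)
  have "finite K"
    unfolding K_def
  proof (intro finite_UN_I finite_imageI)
    fix i assume "i \<in> {i. i < k \<and> deg \<Lambda> l i < p i}"
    then have "e i \<in> NN k"
      by (simp add: NN_def e_def)
    then show "finite {\<alpha> \<in> paths_from \<Lambda> (src \<Lambda> l). deg \<Lambda> \<alpha> = e i}"
      using row_finite src_Obj[OF l(1)] by (auto simp: row_finite_def)
  qed simp
  have KM: "\<mu> \<in> Mor \<Lambda>" if "\<mu> \<in> K" for \<mu>
    using that l(1) cmp_Mor by (auto simp: K_def paths_from_def)
  have "openin Top W" "closedin Top W"
  proof -
    have "closedin Top (\<Union>((\<lambda>\<mu>. cyl (iota k \<Lambda> \<mu>)) ` K))" "openin Top (\<Union>((\<lambda>\<mu>. cyl (iota k \<Lambda> \<mu>)) ` K))"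
      using \<open>finite K\<close> KM iota_Mor open_cyl closed_cyl by (auto intro!: closedin_Union openin_Union)
    then show "openin Top W" "closedin Top W"
      using open_cyl closed_cyl iota_Mor[OF l(1)] by (auto simp: W_def intro: openin_diff closedin_diff)
  qed
  moreover have "iota_path k \<Lambda> z \<in> W \<longleftrightarrow> mcl z 0 p = mcl y 0 p" if z: "z \<in> bdry" for z
  proof -
    note zp = boundary_pathsD(1)[OF z]
    have "valid z 0 p" "valid y 0 p"
      using z y p by (auto simp: valid_def)
    \<comment> \<open>For steps starting at 0 the excesses vanish and the lengths coincide, so only
      first components of keys remain to be compared.\<close>
    then have "mcl z 0 p = mcl y 0 p \<longleftrightarrow> pmor z (0, meetd p (pdeg z)) = l"
      using mcl_eq_iff by (simp add: mor_key_def l_def)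
    also have "\<dots> \<longleftrightarrow> fin (deg \<Lambda> l) \<le> pdeg z \<and> pmor z (0, deg \<Lambda> l) = l \<and>
        (\<forall>\<mu>\<in>K. \<not> (fin (deg \<Lambda> \<mu>) \<le> pdeg z \<and> pmor z (0, deg \<Lambda> \<mu>) = \<mu>))"
    proof (intro iffI conjI ballI notI)
      assume zl: "pmor z (0, meetd p (pdeg z)) = l"
      then have dz: "deg \<Lambda> l = meetd p (pdeg z)"
        using path_morphism(2)[OF zp fun_zero_le fin_meetd_le[of p]] by (simp add: fun_eq_iff)
      then show "fin (deg \<Lambda> l) \<le> pdeg z" "pmor z (0, deg \<Lambda> l) = l"
        using fin_meetd_le zl by simp_all
      fix \<mu> assume "\<mu> \<in> K" and \<mu>: "fin (deg \<Lambda> \<mu>) \<le> pdeg z \<and> pmor z (0, deg \<Lambda> \<mu>) = \<mu>"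
      then obtain i \<alpha> where i: "deg \<Lambda> l i < p i" "\<alpha> \<in> Mor \<Lambda>" "rng \<Lambda> \<alpha> = src \<Lambda> l" "deg \<Lambda> \<alpha> = e i"
        "\<mu> = cmp \<Lambda> l \<alpha>"
        by (auto simp: K_def paths_from_def)
      then have "deg \<Lambda> \<mu> = deg \<Lambda> l + e i"
        using deg_cmp l(1) by simp
      then have "enat (deg \<Lambda> l i + 1) \<le> pdeg z i"
        using \<mu> by (auto simp: le_fun_def fin_def e_def dest: spec[of _ i])
      moreover have "enat (deg \<Lambda> l i) = min (enat (p i)) (pdeg z i)"
        using dz enat_meetd by simp
      ultimately show False
        using i(1) by (cases "pdeg z i") auto
    next
      assume h: "fin (deg \<Lambda> l) \<le> pdeg z \<and> pmor z (0, deg \<Lambda> l) = l \<and>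
        (\<forall>\<mu>\<in>K. \<not> (fin (deg \<Lambda> \<mu>) \<le> pdeg z \<and> pmor z (0, deg \<Lambda> \<mu>) = \<mu>))"
      have "deg \<Lambda> l \<le> meetd p (pdeg z)"
        using h dl meetd_le by (intro le_meetd) auto
      moreover have "meetd p (pdeg z) \<le> deg \<Lambda> l"
      proof (rule ccontr)
        assume "\<not> meetd p (pdeg z) \<le> deg \<Lambda> l"
        \<comment> \<open>In this direction \<open>z\<close> continues beyond \<open>l\<close> while
          still below p; its next edge there produces a member of \<open>K\<close> on
          \<open>z\<close>.\<close>
        then obtain i where i: "deg \<Lambda> l i < meetd p (pdeg z) i"
          by (auto simp: le_fun_def not_le)
        then have pi: "deg \<Lambda> l i < p i" "enat (deg \<Lambda> l i + 1) \<le> pdeg z i"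
          by (cases "pdeg z i"; auto simp: meetd_eq)+
        have "i < k"
          using pi(1) p by (cases "i < k") (auto simp: NN_def)
        have f: "fin (deg \<Lambda> l + e i) \<le> pdeg z"
          using h pi(2) by (auto simp: le_fun_def fin_def e_def)
        let ?\<alpha> = "pmor z (deg \<Lambda> l, deg \<Lambda> l + e i)"
        note \<alpha> = path_morphism[OF zp fun_le_add(1) f]
        have fl: "fin (deg \<Lambda> l) \<le> pdeg z"
          using h by blast
        have c: "cmp \<Lambda> l ?\<alpha> = pmor z (0, deg \<Lambda> l + e i)"
          using path_cmp[OF zp fun_zero_le fun_le_add(1) f] h by simp
        have "src \<Lambda> l = pvert \<Lambda> z (deg \<Lambda> l)"
          using path_morphism(4)[OF zp fun_zero_le fl] h by simp
        then have "cmp \<Lambda> l ?\<alpha> \<in> K"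
          using \<alpha> pi \<open>i < k\<close> by (auto simp: K_def paths_from_def)
        moreover have "deg \<Lambda> (cmp \<Lambda> l ?\<alpha>) = deg \<Lambda> l + e i"
          using c path_morphism(2)[OF zp fun_zero_le f] by (simp add: fun_eq_iff)
        ultimately show False
          using h f c by metis
      qed
      ultimately show "pmor z (0, meetd p (pdeg z)) = l"
        using h by (metis order_antisym)
    qed
    also have "\<dots> \<longleftrightarrow> iota_path k \<Lambda> z \<in> W"
      using iota_path_in_cyl_iota[OF z l(1)] iota_path_in_cyl_iota[OF z KM] by (auto simp: W_def)
    finally show ?thesis
      by simp
  qed
  ultimately show thesis
    using that by blast
qed

lemma continuous_lift:
  "continuous_map (subtopology Top (iota_path k \<Lambda> ` bdry)) Top (lift_path \<circ> inv_into bdry (iota_path k \<Lambda>))"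
    (is "continuous_map ?Y _ ?g")
proof (rule continuous_map_cylinders)
  have Y: "topspace ?Y = iota_path k \<Lambda> ` bdry"
    using topspace_Top proj_lift(2) by auto
  have g: "?g (iota_path k \<Lambda> z) = lift_path z" if "z \<in> bdry" for z
    using that inj_iota_path by simp
  show "?g \<in> topspace ?Y \<rightarrow> path_space k des"
    using Y g lift_path_space by auto
  fix A assume A: "A \<in> Mor des"
  have "\<exists>W. openin Top W \<and> closedin Top W \<and> (\<forall>z\<in>bdry. iota_path k \<Lambda> z \<in> W \<longleftrightarrow> mcl z 0 (deg des A) = A)"
  proof (cases "\<exists>y\<in>bdry. mcl y 0 (deg des A) = A")
    case True
    then obtain y where y: "y \<in> bdry" "mcl y 0 (deg des A) = A"
      by blast
    show ?thesis
      using initial_class_clopen[OF y(1) deg_des_NN[OF A]] unfolding y(2) by metis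
  next
    \<comment> \<open>No lifted path passes through \<open>A\<close>, so the preimage of its
      cylinder is empty.\<close>
    case False
    then show ?thesis
      by (intro exI[of _ "{}"]) auto
  qed
  then obtain W where W: "openin Top W" "closedin Top W"
    "\<And>z. z \<in> bdry \<Longrightarrow> iota_path k \<Lambda> z \<in> W \<longleftrightarrow> mcl z 0 (deg des A) = A"
    by blast
  have eq: "{x \<in> topspace ?Y. ?g x \<in> cyl A} = iota_path k \<Lambda> ` bdry \<inter> W"
    using Y g W(3) lift_in_cyl[OF _ A] by auto
  show "openin ?Y {x \<in> topspace ?Y. ?g x \<in> cyl A} \<and> closedin ?Y {x \<in> topspace ?Y. ?g x \<in> cyl A}"
    unfolding eq using W by (simp add: openin_subtopology_Int2 closedin_subtopology_Int_closed)
qed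

lemma homeomorphic_proj:
  "homeomorphic_map (subtopology Top (embedded_inf_paths k \<Lambda>)) (subtopology Top (iota_path k \<Lambda> ` bdry))
     (proj k \<Lambda>)" (is "homeomorphic_map ?X ?Y _")
proof -
  let ?g = "lift_path \<circ> inv_into bdry (iota_path k \<Lambda>)"
  have X: "topspace ?X = embedded_inf_paths k \<Lambda>"
    using topspace_Top embeddedD(1) by auto
  have Y: "topspace ?Y = iota_path k \<Lambda> ` bdry"
    using topspace_Top proj_lift(2) by auto
  have g: "?g (iota_path k \<Lambda> z) = lift_path z" if "z \<in> bdry" for z
    using that inj_iota_path by simp
  have "homeomorphic_maps ?X ?Y (proj k \<Lambda>) ?g"
    unfolding homeomorphic_maps_def
  proof (intro conjI ballI)
    have "proj k \<Lambda> X \<in> iota_path k \<Lambda> ` bdry" if "X \<in> embedded_inf_paths k \<Lambda>" for X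
      using lift_surj[OF that] proj_lift(1) by (metis imageI)
    then show "continuous_map ?X ?Y (proj k \<Lambda>)"
      using continuous_proj X by (auto simp: continuous_map_in_subtopology)
    show "continuous_map ?Y ?X ?g"
      using continuous_lift Y g lift_embedded by (auto simp: continuous_map_in_subtopology)
    show "?g (proj k \<Lambda> X) = X" if "X \<in> topspace ?X" for X
      using lift_surj[of X] that X proj_lift(1) g by metis
    show "proj k \<Lambda> (?g y) = y" if "y \<in> topspace ?Y" for y
      using that Y g proj_lift(1) by force
  qed
  then show ?thesis
    using homeomorphic_map_maps by blast
qed

end

theorem theorem5p1:
  fixes k :: nat and \<Lambda> :: "('o, 'm) kgraph"
  assumes "k_graph k \<Lambda>"
    and "row_finite k \<Lambda>"
  shows "homeomorphic_map
           (subtopology (path_topology k (desource k \<Lambda>)) (embedded_inf_paths k \<Lambda>))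
           (subtopology (path_topology k (desource k \<Lambda>)) (iota_path k \<Lambda> ` boundary_paths k \<Lambda>))
           (proj k \<Lambda>)"
proof -
  interpret row_finite_k_graph k \<Lambda>
    using assms by (simp add: row_finite_k_graph_def row_finite_k_graph_axioms_def)
  show ?thesis
    by (rule homeomorphic_proj)
qed

end
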